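(* The following are provable in $\mathsf{RCA}_0$, for every countable commutative ring $R$ with unity and ideals $I,J\subseteq R$: (1) if $\sqrt{I}$ and $\sqrt{J}$ are comaximal, then $I$ and $J$ are comaximal; (2) $\sqrt{I\cap J}=\sqrt{I}\cap\sqrt{J}$.
   Context: $\mathsf{RCA}_0$ is the subsystem of second-order arithmetic with basic arithmetic axioms, $\Sigma^0_1$-induction and $\Delta^0_1$-comprehension. $\sqrt{I}=\{a\in R:\exists n>0,\ a^n\in I\}$. Two ideals (or radical classes) $I,J$ are comaximal if every $r\in R$ can be written $r=i+j$ with $i\in I$, $j\in J$. *)

theory Defs
  imports Main
begin

section \<open>The language of second-order arithmetic\<close>

text \<open>Two-sorted language: number variables and set variables live in separate name spaces. As
  usual, equality is primitive for numbers only.\<close>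

type_synonym var = string

datatype tm =
    V var
  | Zero
  | One
  | Add tm tm  (infixl "\<^bold>+" 85)
  | Mul tm tm  (infixl "\<^bold>\<cdot>" 90)

datatype fm =
    Eq tm tm  (infix "\<^bold>=" 70)
  | Less tm tm  (infix "\<^bold><" 70)
  | Mem tm var  (infix "\<^bold>\<in>" 70)
  | Fls  ("\<^bold>\<bottom>")
  | Imp fm fm  (infixr "\<^bold>\<longrightarrow>" 55)
  | AllN var fm
  | AllS var fm

definition Neg :: "fm \<Rightarrow> fm"  ("\<^bold>\<not> _" [65] 65)
  where "\<^bold>\<not> \<phi> = (\<phi> \<^bold>\<longrightarrow> \<^bold>\<bottom>)"
definition Or :: "fm \<Rightarrow> fm \<Rightarrow> fm"  (infixr "\<^bold>\<or>" 58)
  where "\<phi> \<^bold>\<or> \<psi> = (\<^bold>\<not> \<phi> \<^bold>\<longrightarrow> \<psi>)"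
definition And :: "fm \<Rightarrow> fm \<Rightarrow> fm"  (infixr "\<^bold>\<and>" 60)
  where "\<phi> \<^bold>\<and> \<psi> = \<^bold>\<not> (\<phi> \<^bold>\<longrightarrow> \<^bold>\<not> \<psi>)"
definition Iff :: "fm \<Rightarrow> fm \<Rightarrow> fm"  (infix "\<^bold>\<longleftrightarrow>" 53)
  where "(\<phi> \<^bold>\<longleftrightarrow> \<psi>) = (\<phi> \<^bold>\<longrightarrow> \<psi>) \<^bold>\<and> (\<psi> \<^bold>\<longrightarrow> \<phi>)"
definition ExN :: "var \<Rightarrow> fm \<Rightarrow> fm"
  where "ExN x \<phi> = \<^bold>\<not> AllN x (\<^bold>\<not> \<phi>)"
definition ExS :: "var \<Rightarrow> fm \<Rightarrow> fm"
  where "ExS X \<phi> = \<^bold>\<not> AllS X (\<^bold>\<not> \<phi>)"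

fun tvars :: "tm \<Rightarrow> var set" where
  "tvars (V x) = {x}"
| "tvars Zero = {}"
| "tvars One = {}"
| "tvars (s \<^bold>+ t) = tvars s \<union> tvars t"
| "tvars (s \<^bold>\<cdot> t) = tvars s \<union> tvars t"

fun fvN :: "fm \<Rightarrow> var set" where
  "fvN (s \<^bold>= t) = tvars s \<union> tvars t"
| "fvN (s \<^bold>< t) = tvars s \<union> tvars t"
| "fvN (t \<^bold>\<in> X) = tvars t"
| "fvN \<^bold>\<bottom> = {}"
| "fvN (\<phi> \<^bold>\<longrightarrow> \<psi>) = fvN \<phi> \<union> fvN \<psi>"
| "fvN (AllN x \<phi>) = fvN \<phi> - {x}"
| "fvN (AllS X \<phi>) = fvN \<phi>"

fun fvS :: "fm \<Rightarrow> var set" where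
  "fvS (s \<^bold>= t) = {}"
| "fvS (s \<^bold>< t) = {}"
| "fvS (t \<^bold>\<in> X) = {X}"
| "fvS \<^bold>\<bottom> = {}"
| "fvS (\<phi> \<^bold>\<longrightarrow> \<psi>) = fvS \<phi> \<union> fvS \<psi>"
| "fvS (AllN x \<phi>) = fvS \<phi>"
| "fvS (AllS X \<phi>) = fvS \<phi> - {X}"

fun tsubst :: "var \<Rightarrow> tm \<Rightarrow> tm \<Rightarrow> tm" where
  "tsubst x r (V y) = (if y = x then r else V y)"
| "tsubst x r Zero = Zero"
| "tsubst x r One = One"
| "tsubst x r (s \<^bold>+ t) = tsubst x r s \<^bold>+ tsubst x r t"
| "tsubst x r (s \<^bold>\<cdot> t) = tsubst x r s \<^bold>\<cdot> tsubst x r t"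

text \<open>The substitutions replace free occurrences and do not rename bound variables; the predicates
  \<open>free_forN\<close> and \<open>free_forS\<close> say that no capture takes place.\<close>

fun substN :: "var \<Rightarrow> tm \<Rightarrow> fm \<Rightarrow> fm" where
  "substN x r (s \<^bold>= t) = (tsubst x r s \<^bold>= tsubst x r t)"
| "substN x r (s \<^bold>< t) = (tsubst x r s \<^bold>< tsubst x r t)"
| "substN x r (t \<^bold>\<in> X) = (tsubst x r t \<^bold>\<in> X)"
| "substN x r \<^bold>\<bottom> = \<^bold>\<bottom>"
| "substN x r (\<phi> \<^bold>\<longrightarrow> \<psi>) = (substN x r \<phi> \<^bold>\<longrightarrow> substN x r \<psi>)"
| "substN x r (AllN y \<phi>) = AllN y (if y = x then \<phi> else substN x r \<phi>)"
| "substN x r (AllS Y \<phi>) = AllS Y (substN x r \<phi>)"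

fun substS :: "var \<Rightarrow> var \<Rightarrow> fm \<Rightarrow> fm" where
  "substS X Y (s \<^bold>= t) = (s \<^bold>= t)"
| "substS X Y (s \<^bold>< t) = (s \<^bold>< t)"
| "substS X Y (t \<^bold>\<in> Z) = (t \<^bold>\<in> (if Z = X then Y else Z))"
| "substS X Y \<^bold>\<bottom> = \<^bold>\<bottom>"
| "substS X Y (\<phi> \<^bold>\<longrightarrow> \<psi>) = (substS X Y \<phi> \<^bold>\<longrightarrow> substS X Y \<psi>)"
| "substS X Y (AllN z \<phi>) = AllN z (substS X Y \<phi>)"
| "substS X Y (AllS Z \<phi>) = AllS Z (if Z = X then \<phi> else substS X Y \<phi>)"

fun free_forN :: "tm \<Rightarrow> var \<Rightarrow> fm \<Rightarrow> bool" where
  "free_forN r x (\<phi> \<^bold>\<longrightarrow> \<psi>) = (free_forN r x \<phi> \<and> free_forN r x \<psi>)"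
| "free_forN r x (AllN y \<phi>) = (x \<notin> fvN (AllN y \<phi>) \<or> y \<notin> tvars r \<and> free_forN r x \<phi>)"
| "free_forN r x (AllS Y \<phi>) = free_forN r x \<phi>"
| "free_forN r x _ = True"

fun free_forS :: "var \<Rightarrow> var \<Rightarrow> fm \<Rightarrow> bool" where
  "free_forS Y X (\<phi> \<^bold>\<longrightarrow> \<psi>) = (free_forS Y X \<phi> \<and> free_forS Y X \<psi>)"
| "free_forS Y X (AllN z \<phi>) = free_forS Y X \<phi>"
| "free_forS Y X (AllS Z \<phi>) = (X \<notin> fvS (AllS Z \<phi>) \<or> Z \<noteq> Y \<and> free_forS Y X \<phi>)"
| "free_forS Y X _ = True"


section \<open>Provability\<close>

text \<open>A Hilbert calculus for two-sorted classical first-order logic with equality. Generalization is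
  unrestricted, so a non-logical axiom with free variables stands for its universal closure.\<close>

inductive provable :: "fm set \<Rightarrow> fm \<Rightarrow> bool"  (infix "\<turnstile>" 50) for T :: "fm set" where
  Ax: "\<phi> \<in> T \<Longrightarrow> T \<turnstile> \<phi>"
| K: "T \<turnstile> \<phi> \<^bold>\<longrightarrow> \<psi> \<^bold>\<longrightarrow> \<phi>"
| S: "T \<turnstile> (\<phi> \<^bold>\<longrightarrow> \<psi> \<^bold>\<longrightarrow> \<chi>) \<^bold>\<longrightarrow> (\<phi> \<^bold>\<longrightarrow> \<psi>) \<^bold>\<longrightarrow> \<phi> \<^bold>\<longrightarrow> \<chi>"
| DN: "T \<turnstile> \<^bold>\<not> \<^bold>\<not> \<phi> \<^bold>\<longrightarrow> \<phi>"
| InstN: "free_forN t x \<phi> \<Longrightarrow> T \<turnstile> AllN x \<phi> \<^bold>\<longrightarrow> substN x t \<phi>"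
| InstS: "free_forS Y X \<phi> \<Longrightarrow> T \<turnstile> AllS X \<phi> \<^bold>\<longrightarrow> substS X Y \<phi>"
| DistN: "x \<notin> fvN \<phi> \<Longrightarrow> T \<turnstile> AllN x (\<phi> \<^bold>\<longrightarrow> \<psi>) \<^bold>\<longrightarrow> \<phi> \<^bold>\<longrightarrow> AllN x \<psi>"
| DistS: "X \<notin> fvS \<phi> \<Longrightarrow> T \<turnstile> AllS X (\<phi> \<^bold>\<longrightarrow> \<psi>) \<^bold>\<longrightarrow> \<phi> \<^bold>\<longrightarrow> AllS X \<psi>"
| Refl: "T \<turnstile> t \<^bold>= t"
| Leibniz: "free_forN s x \<phi> \<Longrightarrow> free_forN t x \<phi> \<Longrightarrow>
    T \<turnstile> s \<^bold>= t \<^bold>\<longrightarrow> substN x s \<phi> \<^bold>\<longrightarrow> substN x t \<phi>"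
| MP: "T \<turnstile> \<phi> \<^bold>\<longrightarrow> \<psi> \<Longrightarrow> T \<turnstile> \<phi> \<Longrightarrow> T \<turnstile> \<psi>"
| GenN: "T \<turnstile> \<phi> \<Longrightarrow> T \<turnstile> AllN x \<phi>"
| GenS: "T \<turnstile> \<phi> \<Longrightarrow> T \<turnstile> AllS X \<phi>"


section \<open>The axioms of $\mathsf{RCA}_0$\<close>

text \<open>The formulas with bounded number quantifiers only; set variables may occur free.\<close>

inductive sigma00 :: "fm \<Rightarrow> bool" where
  "sigma00 (s \<^bold>= t)"
| "sigma00 (s \<^bold>< t)"
| "sigma00 (t \<^bold>\<in> X)"
| "sigma00 \<^bold>\<bottom>"
| "sigma00 \<phi> \<Longrightarrow> sigma00 \<psi> \<Longrightarrow> sigma00 (\<phi> \<^bold>\<longrightarrow> \<psi>)"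
| "sigma00 \<phi> \<Longrightarrow> x \<notin> tvars t \<Longrightarrow> sigma00 (AllN x (V x \<^bold>< t \<^bold>\<longrightarrow> \<phi>))"
| "sigma00 \<phi> \<Longrightarrow> x \<notin> tvars t \<Longrightarrow> sigma00 (ExN x (V x \<^bold>< t \<^bold>\<and> \<phi>))"

definition sigma01 :: "fm \<Rightarrow> bool"
  where "sigma01 \<phi> \<longleftrightarrow> (\<exists>x \<theta>. sigma00 \<theta> \<and> \<phi> = ExN x \<theta>)"

definition pi01 :: "fm \<Rightarrow> bool"
  where "pi01 \<phi> \<longleftrightarrow> (\<exists>x \<theta>. sigma00 \<theta> \<and> \<phi> = AllN x \<theta>)"

definition basic_axioms :: "fm set" where
  "basic_axioms = (let m = V ''m''; n = V ''n'' in
    { \<^bold>\<not> n \<^bold>+ One \<^bold>= Zero,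
      m \<^bold>+ One \<^bold>= n \<^bold>+ One \<^bold>\<longrightarrow> m \<^bold>= n,
      m \<^bold>+ Zero \<^bold>= m,
      m \<^bold>+ (n \<^bold>+ One) \<^bold>= (m \<^bold>+ n) \<^bold>+ One,
      m \<^bold>\<cdot> Zero \<^bold>= Zero,
      m \<^bold>\<cdot> (n \<^bold>+ One) \<^bold>= (m \<^bold>\<cdot> n) \<^bold>+ m,
      \<^bold>\<not> m \<^bold>< Zero,
      m \<^bold>< n \<^bold>+ One \<^bold>\<longleftrightarrow> m \<^bold>< n \<^bold>\<or> m \<^bold>= n })"

definition sigma01_induction :: "fm set" where
  "sigma01_induction =
    { substN n Zero \<phi> \<^bold>\<and> AllN n (\<phi> \<^bold>\<longrightarrow> substN n (V n \<^bold>+ One) \<phi>) \<^bold>\<longrightarrow> AllN n \<phi> | n \<phi>. sigma01 \<phi> }"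

definition delta01_comprehension :: "fm set" where
  "delta01_comprehension =
    { AllN n (\<phi> \<^bold>\<longleftrightarrow> \<psi>) \<^bold>\<longrightarrow> ExS X (AllN n (V n \<^bold>\<in> X \<^bold>\<longleftrightarrow> \<phi>)) | n X \<phi> \<psi>.
      sigma01 \<phi> \<and> pi01 \<psi> \<and> X \<notin> fvS \<phi> }"

definition RCA0 :: "fm set"
  where "RCA0 = basic_axioms \<union> sigma01_induction \<union> delta01_comprehension"


section \<open>Countable commutative rings within $\mathsf{RCA}_0$\<close>

text \<open>The pairing $(m,n) = (m+n)^2 + m$; functions are sets of pairs and binary operations are sets
  of pairs $((x,y),z)$.\<close>

definition pair :: "tm \<Rightarrow> tm \<Rightarrow> tm"
  where "pair s t = (s \<^bold>+ t) \<^bold>\<cdot> (s \<^bold>+ t) \<^bold>+ s"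

definition All_in :: "var list \<Rightarrow> var \<Rightarrow> fm \<Rightarrow> fm"
  where "All_in xs X \<phi> = foldr (\<lambda>x \<psi>. AllN x (V x \<^bold>\<in> X \<^bold>\<longrightarrow> \<psi>)) xs \<phi>"

definition Ex_in :: "var list \<Rightarrow> var \<Rightarrow> fm \<Rightarrow> fm"
  where "Ex_in xs X \<phi> = foldr (\<lambda>x \<psi>. ExN x (V x \<^bold>\<in> X \<^bold>\<and> \<psi>)) xs \<phi>"

text \<open>The ring structure is given by the fixed set variables \<open>R\<close> (carrier), \<open>A\<close> (addition),
  \<open>M\<close> (multiplication) and the fixed number variables \<open>zero\<close>, \<open>one\<close>. The formulas below bind only
  variables different from these, and number variables passed as arguments are chosen different from
  the variables bound inside.\<close>

abbreviation zeroR :: tm where "zeroR \<equiv> V ''zero''"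
abbreviation oneR :: tm where "oneR \<equiv> V ''one''"

definition app2 :: "var \<Rightarrow> tm \<Rightarrow> tm \<Rightarrow> tm \<Rightarrow> fm"
  where "app2 F s t u = (pair (pair s t) u \<^bold>\<in> F)"

abbreviation sumR :: "tm \<Rightarrow> tm \<Rightarrow> tm \<Rightarrow> fm" where "sumR \<equiv> app2 ''A''"
abbreviation prodR :: "tm \<Rightarrow> tm \<Rightarrow> tm \<Rightarrow> fm" where "prodR \<equiv> app2 ''M''"

definition binary_operation :: "var \<Rightarrow> fm" where
  "binary_operation F = (let x = V ''x''; y = V ''y''; u = V ''u''; v = V ''v''; w = V ''w'' in
    AllN ''w'' (w \<^bold>\<in> F \<^bold>\<longrightarrow> Ex_in [''x'', ''y'', ''u''] ''R'' (w \<^bold>= pair (pair x y) u)) \<^bold>\<and>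
    All_in [''x'', ''y''] ''R'' (Ex_in [''u''] ''R'' (app2 F x y u \<^bold>\<and>
      All_in [''v''] ''R'' (app2 F x y v \<^bold>\<longrightarrow> v \<^bold>= u))))"

definition comm_ring :: fm where
  "comm_ring = (let x = V ''x''; y = V ''y''; z = V ''z'';
      p = V ''p''; q = V ''q''; u = V ''u''; v = V ''v''; w = V ''w'' in
    zeroR \<^bold>\<in> ''R'' \<^bold>\<and> oneR \<^bold>\<in> ''R'' \<^bold>\<and> binary_operation ''A'' \<^bold>\<and> binary_operation ''M'' \<^bold>\<and>
    All_in [''x'', ''y'', ''z'', ''u'', ''v'', ''w'', ''p''] ''R''
      (sumR x y u \<^bold>\<and> sumR u z v \<^bold>\<and> sumR y z w \<^bold>\<and> sumR x w p \<^bold>\<longrightarrow> v \<^bold>= p) \<^bold>\<and>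
    All_in [''x'', ''y'', ''u''] ''R'' (sumR x y u \<^bold>\<longrightarrow> sumR y x u) \<^bold>\<and>
    All_in [''x''] ''R'' (sumR x zeroR x) \<^bold>\<and>
    All_in [''x''] ''R'' (Ex_in [''y''] ''R'' (sumR x y zeroR)) \<^bold>\<and>
    All_in [''x'', ''y'', ''z'', ''u'', ''v'', ''w'', ''p''] ''R''
      (prodR x y u \<^bold>\<and> prodR u z v \<^bold>\<and> prodR y z w \<^bold>\<and> prodR x w p \<^bold>\<longrightarrow> v \<^bold>= p) \<^bold>\<and>
    All_in [''x'', ''y'', ''u''] ''R'' (prodR x y u \<^bold>\<longrightarrow> prodR y x u) \<^bold>\<and>
    All_in [''x''] ''R'' (prodR x oneR x) \<^bold>\<and>
    All_in [''x'', ''y'', ''z'', ''u'', ''v'', ''p'', ''q'', ''w''] ''R''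
      (sumR y z u \<^bold>\<and> prodR x u v \<^bold>\<and> prodR x y p \<^bold>\<and> prodR x z q \<^bold>\<and> sumR p q w \<^bold>\<longrightarrow> v \<^bold>= w))"

definition ideal :: "var \<Rightarrow> fm" where
  "ideal I = (let x = V ''x''; y = V ''y''; u = V ''u'' in
    AllN ''x'' (x \<^bold>\<in> I \<^bold>\<longrightarrow> x \<^bold>\<in> ''R'') \<^bold>\<and>
    zeroR \<^bold>\<in> I \<^bold>\<and>
    All_in [''x'', ''y'', ''u''] ''R'' (x \<^bold>\<in> I \<^bold>\<and> y \<^bold>\<in> I \<^bold>\<and> sumR x y u \<^bold>\<longrightarrow> u \<^bold>\<in> I) \<^bold>\<and>
    All_in [''x'', ''y'', ''u''] ''R'' (y \<^bold>\<in> I \<^bold>\<and> prodR x y u \<^bold>\<longrightarrow> u \<^bold>\<in> I))"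

text \<open>\<open>P\<close> is the function $k \mapsto a^k$ from the natural numbers to the ring, given by primitive
  recursion on $k$.\<close>

definition powers :: "tm \<Rightarrow> var \<Rightarrow> fm" where
  "powers a P = (let k = V ''k''; u = V ''u''; v = V ''v''; w = V ''w'' in
    AllN ''w'' (w \<^bold>\<in> P \<^bold>\<longrightarrow> ExN ''k'' (Ex_in [''u''] ''R'' (w \<^bold>= pair k u))) \<^bold>\<and>
    AllN ''k'' (Ex_in [''u''] ''R'' (pair k u \<^bold>\<in> P \<^bold>\<and>
      All_in [''v''] ''R'' (pair k v \<^bold>\<in> P \<^bold>\<longrightarrow> v \<^bold>= u))) \<^bold>\<and>
    pair Zero oneR \<^bold>\<in> P \<^bold>\<and>
    AllN ''k'' (All_in [''u'', ''v''] ''R''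
      (pair k u \<^bold>\<in> P \<^bold>\<and> prodR u a v \<^bold>\<longrightarrow> pair (k \<^bold>+ One) v \<^bold>\<in> P)))"

text \<open>A radical need not exist as a set within $\mathsf{RCA}_0$, hence radicals are treated as
  definable classes, represented by functions from terms to formulas.\<close>

type_synonym cls = "tm \<Rightarrow> fm"

definition set_class :: "var \<Rightarrow> cls"
  where "set_class X = (\<lambda>t. t \<^bold>\<in> X)"

definition inter_class :: "cls \<Rightarrow> cls \<Rightarrow> cls"
  where "inter_class C D = (\<lambda>t. C t \<^bold>\<and> D t)"

definition radical :: "cls \<Rightarrow> cls" where
  "radical C = (\<lambda>a. a \<^bold>\<in> ''R'' \<^bold>\<and>
    ExN ''n'' (Zero \<^bold>< V ''n'' \<^bold>\<and>
      ExS ''P'' (powers a ''P'' \<^bold>\<and> Ex_in [''u''] ''R'' (pair (V ''n'') (V ''u'') \<^bold>\<in> ''P'' \<^bold>\<and> C (V ''u'')))))"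

definition class_eq :: "cls \<Rightarrow> cls \<Rightarrow> fm"
  where "class_eq C D = AllN ''a'' (C (V ''a'') \<^bold>\<longleftrightarrow> D (V ''a''))"

definition comaximal :: "cls \<Rightarrow> cls \<Rightarrow> fm" where
  "comaximal C D = All_in [''r''] ''R'' (Ex_in [''i'', ''j''] ''R''
    (C (V ''i'') \<^bold>\<and> D (V ''j'') \<^bold>\<and> sumR (V ''i'') (V ''j'') (V ''r'')))"

definition for_all_rings :: "fm \<Rightarrow> fm" where
  "for_all_rings \<phi> = AllS ''R'' (AllS ''A'' (AllS ''M'' (AllN ''zero'' (AllN ''one''
    (comm_ring \<^bold>\<longrightarrow> \<phi>)))))"

definition for_all_ideals :: "var \<Rightarrow> var \<Rightarrow> fm \<Rightarrow> fm" where
  "for_all_ideals I J \<phi> = AllS I (AllS J (ideal I \<^bold>\<and> ideal J \<^bold>\<longrightarrow> \<phi>))"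

end

theory Submission
  imports Defs "HOL-Library.Countable" "HOL-Algebra.Ring"
begin

text \<open>By a completeness theorem for the calculus it suffices to show that both sentences hold in every
  general model of $\mathsf{RCA}_0$. Completeness is Henkin's construction; as the axioms count as
  theorems and not as hypotheses, every stage involves finitely many formulas only, and variables of
  the language itself serve as witnesses.

  In a model, write $1 = i + j$ with $i^n \in I$ and $j^m \in J$. If $1 = a + jc$, then for all $k$ there
  are $d, e$ with $1 = j^k d + a e$, by $\Sigma^0_1$ induction on $k$. Applying this first to the powers
  of $i$ and then to the powers of $j$ gives $1 \in I + J$ without the binomial theorem. For the second
  claim, $a^n \in I$ and $a^m \in J$ give $a^{n+m} \in I \cap J$; as the two memberships may be witnessed
  by different functions $k \mapsto a^k$, one shows by induction that these functions agree.\<close>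

section \<open>Derivations from hypotheses\<close>

text \<open>The numbers of a general model may be nonstandard. Induction of HOL therefore does not
  reach all exponents, and the power operation of the ring library says nothing about
  \<open>a^k\<close> for a nonstandard k. Powers are available only through a set of the model that
  codes the sequence, and every induction on exponents has to be carried by an explicit formula: a
  bounded one behind a single existential number quantifier. The binomial theorem is unattractive
  for the same reason, since its sum would have nonstandard length and would itself have to be
  coded. A step from k to k + 1, by contrast, is one ring identity in finitely many elements. Inside
  a model such an identity can be left to the ring library, because the coded ring becomes an
  ordinary commutative ring of HOL. This is the gain from the semantic detour: no derivation in the
  calculus has to be written out for the algebra.\<close>

inductive derives :: "fm set \<Rightarrow> fm set \<Rightarrow> fm \<Rightarrow> bool" for T \<Gamma> where
  prov: "T \<turnstile> \<phi> \<Longrightarrow> derives T \<Gamma> \<phi>"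
| hyp: "\<phi> \<in> \<Gamma> \<Longrightarrow> derives T \<Gamma> \<phi>"
| mp: "derives T \<Gamma> (\<phi> \<^bold>\<longrightarrow> \<psi>) \<Longrightarrow> derives T \<Gamma> \<phi> \<Longrightarrow> derives T \<Gamma> \<psi>"

lemma provable_imp_refl: "T \<turnstile> \<phi> \<^bold>\<longrightarrow> \<phi>"
  by (rule provable.MP[OF provable.MP[OF provable.S[of _ _ "\<phi> \<^bold>\<longrightarrow> \<phi>"] provable.K] provable.K])

lemma derives_weaken: "derives T \<Gamma> \<psi> \<Longrightarrow> derives T \<Gamma> (\<phi> \<^bold>\<longrightarrow> \<psi>)"
  by (rule derives.mp[OF derives.prov[OF provable.K]])

lemma derives_mono: "derives T \<Gamma> \<phi> \<Longrightarrow> \<Gamma> \<subseteq> \<Delta> \<Longrightarrow> derives T \<Delta> \<phi>"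
  by (induction rule: derives.induct) (auto intro: derives.intros)

lemma derives_empty: "derives T {} \<phi> \<Longrightarrow> T \<turnstile> \<phi>"
  by (induction rule: derives.induct) (auto intro: provable.MP)

text \<open>Generalization is not a rule of \<open>derives\<close>, so the induction meets only
  modus ponens, handled by axiom \<open>S\<close>, and no condition on variables arises.\<close>

lemma deduction:
  assumes "derives T (insert \<psi> \<Gamma>) \<phi>"
  shows "derives T \<Gamma> (\<psi> \<^bold>\<longrightarrow> \<phi>)"
  using assms
proof (induction rule: derives.induct)
  case (prov \<phi>)
  then show ?case by (intro derives_weaken derives.prov)
next
  case (hyp \<phi>)
  then show ?case
    by (auto intro: derives.prov[OF provable_imp_refl] derives_weaken derives.hyp)
next
  case (mp \<phi> \<chi>)
  show ?case by (rule derives.mp[OF derives.mp[OF derives.prov[OF provable.S] mp.IH(1)] mp.IH(2)])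
qed

lemma derives_by_contradiction:
  "derives T (insert (\<^bold>\<not> \<phi>) \<Gamma>) \<^bold>\<bottom> \<Longrightarrow> derives T \<Gamma> \<phi>"
  by (rule derives.mp[OF derives.prov[OF provable.DN]]) (simp add: Neg_def deduction)

lemma derives_finite: "derives T \<Gamma> \<phi> \<Longrightarrow> \<exists>\<Delta>. finite \<Delta> \<and> \<Delta> \<subseteq> \<Gamma> \<and> derives T \<Delta> \<phi>"
proof (induction rule: derives.induct)
  case (prov \<phi>)
  then show ?case by (intro exI[of _ "{}"]) (auto intro: derives.prov)
next
  case (hyp \<phi>)
  then show ?case by (intro exI[of _ "{\<phi>}"]) (auto intro: derives.hyp)
next
  case (mp \<phi> \<psi>)
  then obtain \<Delta> \<Delta>' where "finite \<Delta>" "\<Delta> \<subseteq> \<Gamma>" "derives T \<Delta> (\<phi> \<^bold>\<longrightarrow> \<psi>)"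
    "finite \<Delta>'" "\<Delta>' \<subseteq> \<Gamma>" "derives T \<Delta>' \<phi>"
    by blast
  then show ?case
    by (intro exI[of _ "\<Delta> \<union> \<Delta>'"]) (metis Un_least Un_upper1 Un_upper2 derives.mp derives_mono finite_UnI)
qed

section \<open>Variables, substitution and renaming\<close>

text \<open>Free and bound variables of both sorts are merged, which is possible as both are
  strings. A single condition \<open>y \<notin> vars \<phi>\<close> then makes y fresh as a number
  variable and as a set variable, and rules out capture.\<close>

fun vars :: "fm \<Rightarrow> var set" where
  "vars (s \<^bold>= t) = tvars s \<union> tvars t"
| "vars (s \<^bold>< t) = tvars s \<union> tvars t"
| "vars (t \<^bold>\<in> X) = insert X (tvars t)"
| "vars \<^bold>\<bottom> = {}"
| "vars (\<phi> \<^bold>\<longrightarrow> \<psi>) = vars \<phi> \<union> vars \<psi>"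
| "vars (AllN x \<phi>) = insert x (vars \<phi>)"
| "vars (AllS X \<phi>) = insert X (vars \<phi>)"

lemma finite_tvars [simp]: "finite (tvars t)"
  by (induction t) auto

lemma finite_vars [simp]: "finite (vars \<phi>)"
  by (induction \<phi>) auto

lemma fvN_subset_vars: "fvN \<phi> \<subseteq> vars \<phi>"
  by (induction \<phi>) auto

lemma fvS_subset_vars: "fvS \<phi> \<subseteq> vars \<phi>"
  by (induction \<phi>) auto

lemma notin_fvN: "x \<notin> vars \<phi> \<Longrightarrow> x \<notin> fvN \<phi>"
  using fvN_subset_vars by blast

lemma notin_fvS: "X \<notin> vars \<phi> \<Longrightarrow> X \<notin> fvS \<phi>"
  using fvS_subset_vars by blast

lemma ex_fresh_var: "finite F \<Longrightarrow> \<exists>y :: var. y \<notin> F"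
  by (simp add: ex_new_if_finite infinite_UNIV_listI)

lemma tsubst_fresh [simp]: "x \<notin> tvars t \<Longrightarrow> tsubst x r t = t"
  by (induction t) auto

lemma tsubst_self [simp]: "tsubst x (V x) t = t"
  by (induction t) auto

lemma tsubst_back [simp]: "y \<notin> tvars t \<Longrightarrow> tsubst y (V x) (tsubst x (V y) t) = t"
  by (induction t) auto

lemma tvars_tsubst: "tvars (tsubst x r t) \<subseteq> tvars r \<union> (tvars t - {x})"
  by (induction t) auto

lemma substN_fresh: "x \<notin> fvN \<phi> \<Longrightarrow> substN x r \<phi> = \<phi>"
  by (induction \<phi>) auto

lemma substS_fresh: "X \<notin> fvS \<phi> \<Longrightarrow> substS X Y \<phi> = \<phi>"
  by (induction \<phi>) auto

lemma substN_self [simp]: "substN x (V x) \<phi> = \<phi>"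
  by (induction \<phi>) auto

lemma substS_self [simp]: "substS X X \<phi> = \<phi>"
  by (induction \<phi>) auto

lemma free_forN_self [simp]: "free_forN (V x) x \<phi>"
  by (induction \<phi>) auto

lemma free_forS_self [simp]: "free_forS X X \<phi>"
  by (induction \<phi>) auto

lemma free_forN_fresh: "y \<notin> vars \<phi> \<Longrightarrow> free_forN (V y) x \<phi>"
  by (induction \<phi>) auto

lemma free_forS_fresh: "Y \<notin> vars \<phi> \<Longrightarrow> free_forS Y X \<phi>"
  by (induction \<phi>) auto

text \<open>As y has no bound or free occurrence in the original formula, after renaming it stands
  exactly where x was free. This prepares renaming of bound variables inside the calculus, which has
  no rule for it.\<close>

lemma substN_back: "y \<notin> vars \<phi> \<Longrightarrow> substN y (V x) (substN x (V y) \<phi>) = \<phi>"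
  by (induction \<phi>) (auto simp: substN_fresh notin_fvN)

lemma substS_back: "Y \<notin> vars \<phi> \<Longrightarrow> substS Y X (substS X Y \<phi>) = \<phi>"
  by (induction \<phi>) (auto simp: substS_fresh notin_fvS)

lemma free_forN_back: "y \<notin> vars \<phi> \<Longrightarrow> free_forN (V x) y (substN x (V y) \<phi>)"
  by (induction \<phi>) (auto simp: notin_fvN)

lemma free_forS_back: "Y \<notin> vars \<phi> \<Longrightarrow> free_forS X Y (substS X Y \<phi>)"
  by (induction \<phi>) (auto simp: notin_fvS)

lemma fvN_substN_fresh: "y \<noteq> x \<Longrightarrow> x \<notin> fvN (substN x (V y) \<phi>)"
  using tvars_tsubst by (induction \<phi>) (fastforce)+

lemma fvS_substS_fresh: "Y \<noteq> X \<Longrightarrow> X \<notin> fvS (substS X Y \<phi>)"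
  by (induction \<phi>) auto

section \<open>Generalization under hypotheses\<close>

text \<open>\<open>DistN\<close> wants an antecedent without free x. The two quantified formulas
  have this property although their bodies may not, so they serve as antecedents: under both of them
  \<psi> follows by instantiating x with itself, and can then be generalized.\<close>

lemma provable_AllN_distrib: "T \<turnstile> AllN x (\<phi> \<^bold>\<longrightarrow> \<psi>) \<^bold>\<longrightarrow> AllN x \<phi> \<^bold>\<longrightarrow> AllN x \<psi>"
proof -
  let ?\<alpha> = "AllN x (\<phi> \<^bold>\<longrightarrow> \<psi>)" and ?\<beta> = "AllN x \<phi>"
  have inst: "derives T \<Gamma> \<chi>" if "AllN x \<chi> \<in> \<Gamma>" for \<chi> \<Gamma>
  proof (rule derives.mp[OF derives.prov derives.hyp])
    show "T \<turnstile> AllN x \<chi> \<^bold>\<longrightarrow> \<chi>" using provable.InstN[of "V x" x \<chi> T] by simp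
  qed (rule that)
  have "derives T {?\<beta>, ?\<alpha>} \<psi>"
    by (rule derives.mp[of _ _ \<phi>]) (rule inst, simp)+
  then have "T \<turnstile> ?\<alpha> \<^bold>\<longrightarrow> ?\<beta> \<^bold>\<longrightarrow> \<psi>"
    by (intro derives_empty deduction)
  then have *: "T \<turnstile> ?\<alpha> \<^bold>\<longrightarrow> AllN x (?\<beta> \<^bold>\<longrightarrow> \<psi>)"
    by (intro provable.MP[OF provable.DistN provable.GenN]) simp_all
  have "derives T {?\<alpha>} (AllN x (?\<beta> \<^bold>\<longrightarrow> \<psi>))"
    by (rule derives.mp[OF derives.prov[OF *]]) (simp add: derives.hyp)
  then have "derives T {?\<alpha>} (?\<beta> \<^bold>\<longrightarrow> AllN x \<psi>)"
    by (rule derives.mp[OF derives.prov[OF provable.DistN], rotated]) simp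
  then show ?thesis by (rule derives_empty[OF deduction])
qed

lemma provable_AllS_distrib: "T \<turnstile> AllS X (\<phi> \<^bold>\<longrightarrow> \<psi>) \<^bold>\<longrightarrow> AllS X \<phi> \<^bold>\<longrightarrow> AllS X \<psi>"
proof -
  let ?\<alpha> = "AllS X (\<phi> \<^bold>\<longrightarrow> \<psi>)" and ?\<beta> = "AllS X \<phi>"
  have inst: "derives T \<Gamma> \<chi>" if "AllS X \<chi> \<in> \<Gamma>" for \<chi> \<Gamma>
  proof (rule derives.mp[OF derives.prov derives.hyp])
    show "T \<turnstile> AllS X \<chi> \<^bold>\<longrightarrow> \<chi>" using provable.InstS[of X X \<chi> T] by simp
  qed (rule that)
  have "derives T {?\<beta>, ?\<alpha>} \<psi>"
    by (rule derives.mp[of _ _ \<phi>]) (rule inst, simp)+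
  then have "T \<turnstile> ?\<alpha> \<^bold>\<longrightarrow> ?\<beta> \<^bold>\<longrightarrow> \<psi>"
    by (intro derives_empty deduction)
  then have *: "T \<turnstile> ?\<alpha> \<^bold>\<longrightarrow> AllS X (?\<beta> \<^bold>\<longrightarrow> \<psi>)"
    by (intro provable.MP[OF provable.DistS provable.GenS]) simp_all
  have "derives T {?\<alpha>} (AllS X (?\<beta> \<^bold>\<longrightarrow> \<psi>))"
    by (rule derives.mp[OF derives.prov[OF *]]) (simp add: derives.hyp)
  then have "derives T {?\<alpha>} (?\<beta> \<^bold>\<longrightarrow> AllS X \<psi>)"
    by (rule derives.mp[OF derives.prov[OF provable.DistS], rotated]) simp
  then show ?thesis by (rule derives_empty[OF deduction])
qed

text \<open>The condition on \<Gamma> enters only for a hypothesis itself, which implies its own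
  generalization by \<open>DistN\<close> applied to the generalized trivial implication.\<close>

lemma derives_GenN:
  assumes "derives T \<Gamma> \<phi>" "\<And>\<gamma>. \<gamma> \<in> \<Gamma> \<Longrightarrow> x \<notin> fvN \<gamma>"
  shows "derives T \<Gamma> (AllN x \<phi>)"
  using assms(1)
proof (induction rule: derives.induct)
  case (prov \<phi>)
  then show ?case by (intro derives.prov provable.GenN)
next
  case (hyp \<phi>)
  then have "T \<turnstile> \<phi> \<^bold>\<longrightarrow> AllN x \<phi>"
    by (intro provable.MP[OF provable.DistN provable.GenN] assms(2) provable_imp_refl)
  then show ?case by (rule derives.mp[OF derives.prov derives.hyp[OF hyp]])
next
  case (mp \<phi> \<psi>)
  show ?case by (rule derives.mp[OF derives.mp[OF derives.prov[OF provable_AllN_distrib] mp.IH(1)] mp.IH(2)])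
qed

lemma derives_GenS:
  assumes "derives T \<Gamma> \<phi>" "\<And>\<gamma>. \<gamma> \<in> \<Gamma> \<Longrightarrow> X \<notin> fvS \<gamma>"
  shows "derives T \<Gamma> (AllS X \<phi>)"
  using assms(1)
proof (induction rule: derives.induct)
  case (prov \<phi>)
  then show ?case by (intro derives.prov provable.GenS)
next
  case (hyp \<phi>)
  then have "T \<turnstile> \<phi> \<^bold>\<longrightarrow> AllS X \<phi>"
    by (intro provable.MP[OF provable.DistS provable.GenS] assms(2) provable_imp_refl)
  then show ?case by (rule derives.mp[OF derives.prov derives.hyp[OF hyp]])
next
  case (mp \<phi> \<psi>)
  show ?case by (rule derives.mp[OF derives.mp[OF derives.prov[OF provable_AllS_distrib] mp.IH(1)] mp.IH(2)])
qed

text \<open>Renaming of the bound variable: generalize over the fresh y, instantiate y by x, which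
  restores \<phi> by \<open>substN_back\<close>, and generalize over x.\<close>

lemma derives_AllN_fresh:
  assumes "derives T \<Gamma> (substN x (V y) \<phi>)" "y \<notin> vars \<phi>" "\<And>\<gamma>. \<gamma> \<in> \<Gamma> \<Longrightarrow> y \<notin> vars \<gamma>"
  shows "derives T \<Gamma> (AllN x \<phi>)"
proof (cases "y = x")
  case True
  with assms(1) have "derives T \<Gamma> \<phi>" by simp
  then show ?thesis using assms(3) True by (intro derives_GenN notin_fvN) simp_all
next
  case False
  let ?\<psi> = "AllN y (substN x (V y) \<phi>)"
  have "T \<turnstile> ?\<psi> \<^bold>\<longrightarrow> \<phi>"
    using provable.InstN[OF free_forN_back[OF assms(2), of x]] assms(2) by (simp add: substN_back)
  then have "T \<turnstile> ?\<psi> \<^bold>\<longrightarrow> AllN x \<phi>"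
    using False by (intro provable.MP[OF provable.DistN] provable.GenN) (simp_all add: fvN_substN_fresh)
  moreover have "derives T \<Gamma> ?\<psi>"
    using assms(3) by (intro derives_GenN[OF assms(1)] notin_fvN)
  ultimately show ?thesis by (rule derives.mp[OF derives.prov])
qed

lemma derives_AllS_fresh:
  assumes "derives T \<Gamma> (substS X Y \<phi>)" "Y \<notin> vars \<phi>" "\<And>\<gamma>. \<gamma> \<in> \<Gamma> \<Longrightarrow> Y \<notin> vars \<gamma>"
  shows "derives T \<Gamma> (AllS X \<phi>)"
proof (cases "Y = X")
  case True
  with assms(1) have "derives T \<Gamma> \<phi>" by simp
  then show ?thesis using assms(3) True by (intro derives_GenS notin_fvS) simp_all
next
  case False
  let ?\<psi> = "AllS Y (substS X Y \<phi>)"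
  have "T \<turnstile> ?\<psi> \<^bold>\<longrightarrow> \<phi>"
    using provable.InstS[OF free_forS_back[OF assms(2), of X]] assms(2) by (simp add: substS_back)
  then have "T \<turnstile> ?\<psi> \<^bold>\<longrightarrow> AllS X \<phi>"
    using False by (intro provable.MP[OF provable.DistS] provable.GenS) (simp_all add: fvS_substS_fresh)
  moreover have "derives T \<Gamma> ?\<psi>"
    using assms(3) by (intro derives_GenS[OF assms(1)] notin_fvS)
  ultimately show ?thesis by (rule derives.mp[OF derives.prov])
qed


section \<open>Henkin sets\<close>

instance tm :: countable by countable_datatype
instance fm :: countable by countable_datatype

text \<open>Choosing witnesses outside an arbitrary finite set of variables replaces the renaming of bound
  variables: every element of the term model is named by a variable that can be substituted into a
  given formula without capture.\<close>

locale henkin =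
  fixes T H :: "fm set"
  assumes closed: "derives T H \<phi> \<Longrightarrow> \<phi> \<in> H"
    and consistent: "\<^bold>\<bottom> \<notin> H"
    and complete: "\<phi> \<in> H \<or> \<^bold>\<not> \<phi> \<in> H"
    and witnessN: "\<^bold>\<not> AllN x \<phi> \<in> H \<Longrightarrow> finite F \<Longrightarrow> \<exists>y. y \<notin> F \<and> \<^bold>\<not> substN x (V y) \<phi> \<in> H"
    and witnessS: "\<^bold>\<not> AllS X \<phi> \<in> H \<Longrightarrow> finite F \<Longrightarrow> \<exists>Y. Y \<notin> F \<and> \<^bold>\<not> substS X Y \<phi> \<in> H"

section \<open>Building a Henkin set around a consistent formula\<close>

text \<open>Patterns must consist of constructors, so a negated quantifier is matched in its
  unfolded form, an implication of falsity.\<close>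

fun witness :: "fm \<Rightarrow> var \<Rightarrow> fm set" where
  "witness (AllN x \<phi> \<^bold>\<longrightarrow> \<^bold>\<bottom>) y = {\<^bold>\<not> substN x (V y) \<phi>}"
| "witness (AllS X \<phi> \<^bold>\<longrightarrow> \<^bold>\<bottom>) y = {\<^bold>\<not> substS X y \<phi>}"
| "witness _ _ = {}"

lemma finite_witness: "finite (witness \<psi> y)"
  by (induction \<psi> y rule: witness.induct) auto

lemma witness_cases:
  "(\<exists>x \<phi>. \<psi> = (AllN x \<phi> \<^bold>\<longrightarrow> \<^bold>\<bottom>)) \<or> (\<exists>X \<phi>. \<psi> = (AllS X \<phi> \<^bold>\<longrightarrow> \<^bold>\<bottom>)) \<or> witness \<psi> y = {}"
  by (induction \<psi> y rule: witness.induct) auto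

text \<open>If the new witness led to a contradiction, the instance at y would be derivable. Since y
  does not occur in \<Gamma>, so would the universal formula, which \<psi> denies.\<close>

lemma consistent_witness:
  assumes "\<not> derives T \<Gamma> \<^bold>\<bottom>" "\<psi> \<in> \<Gamma>" "\<And>\<gamma>. \<gamma> \<in> \<Gamma> \<Longrightarrow> y \<notin> vars \<gamma>"
  shows "\<not> derives T (\<Gamma> \<union> witness \<psi> y) \<^bold>\<bottom>"
proof
  assume *: "derives T (\<Gamma> \<union> witness \<psi> y) \<^bold>\<bottom>"
  consider x \<phi> where "\<psi> = (AllN x \<phi> \<^bold>\<longrightarrow> \<^bold>\<bottom>)" | X \<phi> where "\<psi> = (AllS X \<phi> \<^bold>\<longrightarrow> \<^bold>\<bottom>)"
    | "witness \<psi> y = {}"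
    using witness_cases by metis
  then show False
  proof cases
    case 1
    with * have "derives T \<Gamma> (substN x (V y) \<phi>)"
      by (simp add: derives_by_contradiction)
    then have "derives T \<Gamma> (AllN x \<phi>)"
    proof (rule derives_AllN_fresh)
      show "y \<notin> vars \<phi>" using assms(3)[OF assms(2)] 1 by simp
    qed (rule assms(3))
    then have "derives T \<Gamma> \<^bold>\<bottom>" by (rule derives.mp[OF derives.hyp[OF assms(2)[unfolded 1]]])
    with assms(1) show False ..
  next
    case 2
    with * have "derives T \<Gamma> (substS X y \<phi>)"
      by (simp add: derives_by_contradiction)
    then have "derives T \<Gamma> (AllS X \<phi>)"
    proof (rule derives_AllS_fresh)
      show "y \<notin> vars \<phi>" using assms(3)[OF assms(2)] 2 by simp
    qed (rule assms(3))
    then have "derives T \<Gamma> \<^bold>\<bottom>" by (rule derives.mp[OF derives.hyp[OF assms(2)[unfolded 2]]])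
    with assms(1) show False ..
  next
    case 3
    with * assms show False by simp
  qed
qed

definition fresh :: "var set \<Rightarrow> var" where
  "fresh F = (SOME y. y \<notin> F)"

lemma fresh_notin: "finite F \<Longrightarrow> fresh F \<notin> F"
  unfolding fresh_def using ex_fresh_var by (rule someI_ex)

text \<open>The enumeration runs through pairs and not just formulas: each formula comes up once
  with every finite list \<open>ys\<close> of forbidden variables. This is what yields witnesses
  outside an arbitrary finite set.\<close>

definition henkin_step :: "fm set \<Rightarrow> fm \<times> var list \<Rightarrow> fm set \<Rightarrow> fm set" where
  "henkin_step T = (\<lambda>(\<psi>, ys) \<Gamma>. if derives T (insert \<psi> \<Gamma>) \<^bold>\<bottom> then \<Gamma>
     else insert \<psi> \<Gamma> \<union> witness \<psi> (fresh (set ys \<union> (\<Union>\<gamma>\<in>insert \<psi> \<Gamma>. vars \<gamma>))))"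

fun henkin_chain :: "fm set \<Rightarrow> fm \<Rightarrow> nat \<Rightarrow> fm set" where
  "henkin_chain T \<phi> 0 = {\<phi>}"
| "henkin_chain T \<phi> (Suc n) = henkin_step T (from_nat n) (henkin_chain T \<phi> n)"

lemma finite_henkin_chain: "finite (henkin_chain T \<phi> n)"
  by (induction n) (auto simp: henkin_step_def finite_witness split: prod.split)

lemma consistent_henkin_chain:
  assumes "\<not> derives T {\<phi>} \<^bold>\<bottom>"
  shows "\<not> derives T (henkin_chain T \<phi> n) \<^bold>\<bottom>"
proof (induction n)
  case 0
  with assms show ?case by simp
next
  case (Suc n)
  obtain \<psi> ys where eq: "from_nat n = (\<psi> :: fm, ys :: var list)" by force
  let ?\<Gamma> = "insert \<psi> (henkin_chain T \<phi> n)"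
  let ?F = "set ys \<union> (\<Union>\<gamma>\<in>?\<Gamma>. vars \<gamma>)"
  have "fresh ?F \<notin> ?F"
    by (rule fresh_notin) (simp add: finite_henkin_chain)
  then have "\<not> derives T ?\<Gamma> \<^bold>\<bottom> \<Longrightarrow> \<not> derives T (?\<Gamma> \<union> witness \<psi> (fresh ?F)) \<^bold>\<bottom>"
    by (intro consistent_witness) auto
  with Suc show ?case by (simp add: eq henkin_step_def)
qed

lemma henkin_chain_mono: "m \<le> n \<Longrightarrow> henkin_chain T \<phi> m \<subseteq> henkin_chain T \<phi> n"
  by (rule lift_Suc_mono_le[of "henkin_chain T \<phi>"]) (auto simp: henkin_step_def split: prod.split)

lemma ex_henkin:
  assumes "\<not> derives T {\<phi>} \<^bold>\<bottom>"
  obtains H where "henkin T H" "\<phi> \<in> H"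
proof
  let ?C = "henkin_chain T \<phi>"
  let ?H = "\<Union>n. ?C n"
  show "\<phi> \<in> ?H" by (auto intro!: exI[of _ 0])
  have cons: "\<not> derives T ?H \<^bold>\<bottom>"
  proof
    assume "derives T ?H \<^bold>\<bottom>"
    then obtain \<Delta> where \<Delta>: "finite \<Delta>" "\<Delta> \<subseteq> ?H" "derives T \<Delta> \<^bold>\<bottom>" using derives_finite[of T ?H] by auto
    from \<Delta>(1,2) have "\<exists>n. \<Delta> \<subseteq> ?C n"
    proof (induction \<Delta> rule: finite_induct)
      case (insert \<delta> \<Delta>)
      then obtain m n where "\<Delta> \<subseteq> ?C n" "\<delta> \<in> ?C m" by auto
      then have "insert \<delta> \<Delta> \<subseteq> ?C (max m n)"
        using henkin_chain_mono[of m "max m n"] henkin_chain_mono[of n "max m n"] by fastforce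
      then show ?case ..
    qed simp
    then show False using \<Delta>(3) consistent_henkin_chain[OF assms] derives_mono by metis
  qed
  \<comment> \<open>A formula consistent with the limit is consistent with the smaller stage at
    which its pair is treated, so it is accepted there together with a witness.\<close>
  have stage: "\<not> derives T (insert \<psi> ?H) \<^bold>\<bottom> \<Longrightarrow>
      \<exists>y. y \<notin> set ys \<and> insert \<psi> (witness \<psi> y) \<subseteq> ?H" for \<psi> ys
  proof -
    assume "\<not> derives T (insert \<psi> ?H) \<^bold>\<bottom>"
    moreover define n where "n = to_nat (\<psi>, ys)"
    ultimately have "\<not> derives T (insert \<psi> (?C n)) \<^bold>\<bottom>"
      using derives_mono[of T "insert \<psi> (?C n)" _ "insert \<psi> ?H"] by blast
    moreover define F where "F = set ys \<union> (\<Union>\<gamma>\<in>insert \<psi> (?C n). vars \<gamma>)"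
    ultimately have "?C (Suc n) = insert \<psi> (?C n) \<union> witness \<psi> (fresh F)"
      by (simp add: henkin_step_def n_def)
    moreover have "fresh F \<notin> F"
      unfolding F_def by (rule fresh_notin) (simp add: finite_henkin_chain)
    ultimately show ?thesis
      by (intro exI[of _ "fresh F"]) (auto simp: F_def simp del: henkin_chain.simps)
  qed
  have closed: "\<psi> \<in> ?H" if "derives T ?H \<psi>" for \<psi>
  proof -
    have "\<not> derives T (insert \<psi> ?H) \<^bold>\<bottom>"
      using derives.mp[OF deduction that] cons by blast
    then show ?thesis using stage[of \<psi> "[]"] by simp
  qed
  show "henkin T ?H"
  proof
    show "\<psi> \<in> ?H" if "derives T ?H \<psi>" for \<psi> using that by (rule closed)
    show "\<^bold>\<bottom> \<notin> ?H" using cons derives.hyp by blast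
    show "\<psi> \<in> ?H \<or> \<^bold>\<not> \<psi> \<in> ?H" for \<psi>
    proof (cases "derives T (insert \<psi> ?H) \<^bold>\<bottom>")
      case True
      then have "\<^bold>\<not> \<psi> \<in> ?H" unfolding Neg_def by (intro closed deduction)
      then show ?thesis ..
    next
      case False
      then show ?thesis using stage[of \<psi> "[]"] by blast
    qed
    have wit: "\<exists>y. y \<notin> F \<and> witness \<psi> y \<subseteq> ?H" if "\<psi> \<in> ?H" "finite F" for \<psi> F
    proof -
      obtain ys where "F = set ys" using finite_list[OF \<open>finite F\<close>] by auto
      \<comment> \<open>\<psi> is already in the limit, so inserting it changes nothing and
        consistency of the limit suffices.\<close>
      then show ?thesis using stage[of \<psi> ys] cons \<open>\<psi> \<in> ?H\<close> by (auto simp: insert_absorb)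
    qed
    show "\<exists>y. y \<notin> F \<and> \<^bold>\<not> substN x (V y) \<psi> \<in> ?H" if "\<^bold>\<not> AllN x \<psi> \<in> ?H" "finite F" for x \<psi> F
      using wit[OF that] by (simp add: Neg_def)
    show "\<exists>Y. Y \<notin> F \<and> \<^bold>\<not> substS X Y \<psi> \<in> ?H" if "\<^bold>\<not> AllS X \<psi> \<in> ?H" "finite F" for X \<psi> F
      using wit[OF that] by (simp add: Neg_def)
  qed
qed

section \<open>General models and completeness\<close>

record 'a model =
  numbers :: "'a set"
  subsets :: "'a set set"
  nzero :: 'a
  none :: 'a
  nadd :: "'a \<Rightarrow> 'a \<Rightarrow> 'a"
  nmul :: "'a \<Rightarrow> 'a \<Rightarrow> 'a"
  nless :: "'a \<Rightarrow> 'a \<Rightarrow> bool"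

primrec tval :: "'a model \<Rightarrow> (var \<Rightarrow> 'a) \<Rightarrow> tm \<Rightarrow> 'a" where
  "tval M e (V x) = e x"
| "tval M e Zero = nzero M"
| "tval M e One = none M"
| "tval M e (s \<^bold>+ t) = nadd M (tval M e s) (tval M e t)"
| "tval M e (s \<^bold>\<cdot> t) = nmul M (tval M e s) (tval M e t)"

primrec sat :: "'a model \<Rightarrow> (var \<Rightarrow> 'a) \<Rightarrow> (var \<Rightarrow> 'a set) \<Rightarrow> fm \<Rightarrow> bool" where
  "sat M e E (s \<^bold>= t) \<longleftrightarrow> tval M e s = tval M e t"
| "sat M e E (s \<^bold>< t) \<longleftrightarrow> nless M (tval M e s) (tval M e t)"
| "sat M e E (t \<^bold>\<in> X) \<longleftrightarrow> tval M e t \<in> E X"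
| "sat M e E \<^bold>\<bottom> \<longleftrightarrow> False"
| "sat M e E (\<phi> \<^bold>\<longrightarrow> \<psi>) \<longleftrightarrow> (sat M e E \<phi> \<longrightarrow> sat M e E \<psi>)"
| "sat M e E (AllN x \<phi>) \<longleftrightarrow> (\<forall>d\<in>numbers M. sat M (e(x := d)) E \<phi>)"
| "sat M e E (AllS X \<phi>) \<longleftrightarrow> (\<forall>D\<in>subsets M. sat M e (E(X := D)) \<phi>)"

lemma sat_Neg [simp]: "sat M e E (\<^bold>\<not> \<phi>) \<longleftrightarrow> \<not> sat M e E \<phi>"
  by (simp add: Neg_def)

lemma sat_Or [simp]: "sat M e E (\<phi> \<^bold>\<or> \<psi>) \<longleftrightarrow> sat M e E \<phi> \<or> sat M e E \<psi>"
  by (auto simp: Or_def)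

lemma sat_And [simp]: "sat M e E (\<phi> \<^bold>\<and> \<psi>) \<longleftrightarrow> sat M e E \<phi> \<and> sat M e E \<psi>"
  by (simp add: And_def)

lemma sat_Iff [simp]: "sat M e E (\<phi> \<^bold>\<longleftrightarrow> \<psi>) \<longleftrightarrow> (sat M e E \<phi> \<longleftrightarrow> sat M e E \<psi>)"
  by (auto simp: Iff_def)

lemma sat_ExN [simp]: "sat M e E (ExN x \<phi>) \<longleftrightarrow> (\<exists>d\<in>numbers M. sat M (e(x := d)) E \<phi>)"
  by (simp add: ExN_def)

lemma sat_ExS [simp]: "sat M e E (ExS X \<phi>) \<longleftrightarrow> (\<exists>D\<in>subsets M. sat M e (E(X := D)) \<phi>)"
  by (simp add: ExS_def)

lemma tval_cong: "(\<And>x. x \<in> tvars t \<Longrightarrow> e x = e' x) \<Longrightarrow> tval M e t = tval M e' t"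
  by (induction t) auto

lemma sat_cong:
  assumes "\<And>x. x \<in> fvN \<phi> \<Longrightarrow> e x = e' x" "\<And>X. X \<in> fvS \<phi> \<Longrightarrow> E X = E' X"
  shows "sat M e E \<phi> \<longleftrightarrow> sat M e' E' \<phi>"
  using assms
proof (induction \<phi> arbitrary: e e' E E')
  case (Eq s t)
  then show ?case using tval_cong[of s e e'] tval_cong[of t e e'] by auto
next
  case (Less s t)
  then show ?case using tval_cong[of s e e'] tval_cong[of t e e'] by auto
next
  case (Mem t X)
  then show ?case using tval_cong[of t e e'] by auto
next
  case (Imp \<phi> \<psi>)
  from Imp.IH(1)[of e e' E E'] Imp.IH(2)[of e e' E E'] Imp.prems show ?case by simp
next
  case (AllN x \<phi>)
  have "sat M (e(x := d)) E \<phi> \<longleftrightarrow> sat M (e'(x := d)) E' \<phi>" for d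
    using AllN.prems by (intro AllN.IH) auto
  then show ?case by simp
next
  case (AllS X \<phi>)
  have "sat M e (E(X := D)) \<phi> \<longleftrightarrow> sat M e' (E'(X := D)) \<phi>" for D
    using AllS.prems by (intro AllS.IH) auto
  then show ?case by simp
qed simp

lemma tval_tsubst: "tval M e (tsubst x r t) = tval M (e(x := tval M e r)) t"
  by (induction t) auto

lemma sat_substN:
  "free_forN r x \<phi> \<Longrightarrow> sat M e E (substN x r \<phi>) \<longleftrightarrow> sat M (e(x := tval M e r)) E \<phi>"
proof (induction \<phi> arbitrary: e E)
  case (AllN y \<phi>)
  show ?case
  proof (cases "x \<in> fvN (AllN y \<phi>)")
    case True
    with AllN.prems have y: "y \<noteq> x" "y \<notin> tvars r" "free_forN r x \<phi>" by auto
    have "sat M (e(y := d)) E (substN x r \<phi>) \<longleftrightarrow> sat M (e(x := tval M e r, y := d)) E \<phi>" for d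
    proof -
      have "tval M (e(y := d)) r = tval M e r" using y(2) by (intro tval_cong) auto
      then show ?thesis
        unfolding AllN.IH[OF y(3)] using fun_upd_twist[OF y(1)[symmetric], of e] by simp
    qed
    with y(1) show ?thesis by (simp del: fun_upd_apply)
  next
    case False
    then show ?thesis by (subst substN_fresh) (auto intro!: sat_cong simp del: sat.simps)
  qed
qed (simp_all add: tval_tsubst)

lemma sat_substS: "free_forS Y X \<phi> \<Longrightarrow> sat M e E (substS X Y \<phi>) \<longleftrightarrow> sat M e (E(X := E Y)) \<phi>"
proof (induction \<phi> arbitrary: e E)
  case (AllS Z \<phi>)
  show ?case
  proof (cases "X \<in> fvS (AllS Z \<phi>)")
    case True
    with AllS.prems have Z: "Z \<noteq> X" "Z \<noteq> Y" "free_forS Y X \<phi>" by auto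
    have "sat M e (E(Z := D)) (substS X Y \<phi>) \<longleftrightarrow> sat M e (E(X := E Y, Z := D)) \<phi>" for D
      unfolding AllS.IH[OF Z(3)] using Z(2) fun_upd_twist[OF Z(1)[symmetric], of E] by simp
    with Z(1) show ?thesis by (simp del: fun_upd_apply)
  next
    case False
    then show ?thesis by (subst substS_fresh) (auto intro!: sat_cong simp del: sat.simps split: if_splits)
  qed
qed simp_all

text \<open>Henkin semantics: \<open>subsets\<close> may be any nonempty family of subsets of the
  domain and need not be the full power set. Completeness holds for this notion of model.\<close>

definition wf_model :: "'a model \<Rightarrow> bool" where
  "wf_model M \<longleftrightarrow> nzero M \<in> numbers M \<and> none M \<in> numbers M \<and>
     (\<forall>a\<in>numbers M. \<forall>b\<in>numbers M. nadd M a b \<in> numbers M \<and> nmul M a b \<in> numbers M) \<and>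
     subsets M \<noteq> {} \<and> (\<forall>D\<in>subsets M. D \<subseteq> numbers M)"

definition valid :: "'a model \<Rightarrow> fm \<Rightarrow> bool" where
  "valid M \<phi> \<longleftrightarrow> (\<forall>e E. (\<forall>x. e x \<in> numbers M) \<longrightarrow> (\<forall>X. E X \<in> subsets M) \<longrightarrow> sat M e E \<phi>)"

lemma validD:
  "valid M \<phi> \<Longrightarrow> (\<And>x. e x \<in> numbers M) \<Longrightarrow> (\<And>X. E X \<in> subsets M) \<Longrightarrow> sat M e E \<phi>"
  by (simp add: valid_def)

text \<open>The truth lemma will concern one particular assignment. Passing through a universal
  closure that holds there carries truth over to the other assignments.\<close>

lemma sat_foldr_AllN:
  assumes "sat M e E (foldr AllN xs \<phi>)" "\<And>x. e' x \<in> numbers M" "\<And>x. x \<notin> set xs \<Longrightarrow> e' x = e x"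
  shows "sat M e' E \<phi>"
  using assms
proof (induction xs arbitrary: e)
  case Nil
  then have "e' = e" by auto
  with Nil show ?case by simp
next
  case (Cons x xs)
  then have "sat M (e(x := e' x)) E (foldr AllN xs \<phi>)" by simp
  then show ?case by (rule Cons.IH) (use Cons.prems in auto)
qed

lemma sat_foldr_AllS:
  assumes "sat M e E (foldr AllS Xs \<phi>)" "\<And>X. E' X \<in> subsets M" "\<And>X. X \<notin> set Xs \<Longrightarrow> E' X = E X"
  shows "sat M e E' \<phi>"
  using assms
proof (induction Xs arbitrary: E)
  case Nil
  then have "E' = E" by auto
  with Nil show ?case by simp
next
  case (Cons X Xs)
  then have "sat M e (E(X := E' X)) (foldr AllS Xs \<phi>)" by simp
  then show ?case by (rule Cons.IH) (use Cons.prems in auto)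
qed

text \<open>Measure for the truth lemma: its quantifier cases appeal to a substituted body, which is
  no subformula but has the same rank as the body.\<close>

primrec rank :: "fm \<Rightarrow> nat" where
  "rank (s \<^bold>= t) = 0"
| "rank (s \<^bold>< t) = 0"
| "rank (t \<^bold>\<in> X) = 0"
| "rank \<^bold>\<bottom> = 0"
| "rank (\<phi> \<^bold>\<longrightarrow> \<psi>) = Suc (rank \<phi> + rank \<psi>)"
| "rank (AllN x \<phi>) = Suc (rank \<phi>)"
| "rank (AllS X \<phi>) = Suc (rank \<phi>)"

lemma rank_substN [simp]: "rank (substN x r \<phi>) = rank \<phi>"
  by (induction \<phi>) auto

lemma rank_substS [simp]: "rank (substS X Y \<phi>) = rank \<phi>"
  by (induction \<phi>) auto

section \<open>The term model of a Henkin set\<close>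

context henkin
begin

lemma provable_in: "T \<turnstile> \<phi> \<Longrightarrow> \<phi> \<in> H"
  by (intro closed derives.prov)

lemma mp_in: "\<phi> \<^bold>\<longrightarrow> \<psi> \<in> H \<Longrightarrow> \<phi> \<in> H \<Longrightarrow> \<psi> \<in> H"
  by (rule closed[OF derives.mp[OF derives.hyp derives.hyp]])

lemma Neg_in [simp]: "\<^bold>\<not> \<phi> \<in> H \<longleftrightarrow> \<phi> \<notin> H"
  using complete consistent mp_in unfolding Neg_def by blast

lemma Fls_in [simp]: "\<^bold>\<bottom> \<notin> H"
  by (rule consistent)

lemma Imp_in [simp]: "\<phi> \<^bold>\<longrightarrow> \<psi> \<in> H \<longleftrightarrow> (\<phi> \<in> H \<longrightarrow> \<psi> \<in> H)"
proof (cases "\<phi> \<in> H")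
  case True
  then show ?thesis using mp_in[OF provable_in[OF provable.K]] mp_in by blast
next
  case False
  then have "derives T H (\<phi> \<^bold>\<longrightarrow> \<^bold>\<bottom>)" using Neg_in derives.hyp by (metis Neg_def)
  then have "derives T (insert (\<^bold>\<not> \<psi>) (insert \<phi> H)) (\<phi> \<^bold>\<longrightarrow> \<^bold>\<bottom>)"
    by (rule derives_mono) auto
  then have "derives T (insert (\<^bold>\<not> \<psi>) (insert \<phi> H)) \<^bold>\<bottom>"
    by (rule derives.mp) (simp add: derives.hyp)
  then have "derives T H (\<phi> \<^bold>\<longrightarrow> \<psi>)"
    by (rule deduction[OF derives_by_contradiction])
  with False show ?thesis using closed by blast
qed

lemma And_in [simp]: "\<phi> \<^bold>\<and> \<psi> \<in> H \<longleftrightarrow> \<phi> \<in> H \<and> \<psi> \<in> H"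
  by (simp add: And_def)

lemma Iff_in [simp]: "\<phi> \<^bold>\<longleftrightarrow> \<psi> \<in> H \<longleftrightarrow> (\<phi> \<in> H \<longleftrightarrow> \<psi> \<in> H)"
  by (auto simp: Iff_def)

lemma AllN_inD: "AllN x \<phi> \<in> H \<Longrightarrow> free_forN t x \<phi> \<Longrightarrow> substN x t \<phi> \<in> H"
  by (rule mp_in[OF provable_in[OF provable.InstN]])

lemma AllS_inD: "AllS X \<phi> \<in> H \<Longrightarrow> free_forS Y X \<phi> \<Longrightarrow> substS X Y \<phi> \<in> H"
  by (rule mp_in[OF provable_in[OF provable.InstS]])

lemma Leibniz_in:
  "s \<^bold>= t \<in> H \<Longrightarrow> free_forN s x \<phi> \<Longrightarrow> free_forN t x \<phi> \<Longrightarrow> substN x s \<phi> \<in> H \<Longrightarrow> substN x t \<phi> \<in> H"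
  by (rule mp_in[OF mp_in[OF provable_in[OF provable.Leibniz]]])

lemma eq_refl: "t \<^bold>= t \<in> H"
  by (rule provable_in[OF provable.Refl])

lemma eq_sym: "s \<^bold>= t \<in> H \<Longrightarrow> t \<^bold>= s \<in> H"
proof -
  assume *: "s \<^bold>= t \<in> H"
  obtain x where "x \<notin> tvars s" using ex_fresh_var[of "tvars s"] by auto
  then show ?thesis using Leibniz_in[OF *, of x "V x \<^bold>= s"] eq_refl by simp
qed

lemma eq_trans: "s \<^bold>= t \<in> H \<Longrightarrow> r \<^bold>= s \<in> H \<Longrightarrow> r \<^bold>= t \<in> H"
proof -
  assume *: "s \<^bold>= t \<in> H" "r \<^bold>= s \<in> H"
  obtain x where "x \<notin> tvars r" using ex_fresh_var[of "tvars r"] by auto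
  then show ?thesis using Leibniz_in[OF *(1), of x "r \<^bold>= V x"] * by simp
qed

text \<open>\<open>sat\<close> interprets the equality sign as identity, so terms that H declares
  equal have to become the same element.\<close>

definition cl :: "tm \<Rightarrow> tm set" where
  "cl t = {s. s \<^bold>= t \<in> H}"

lemma cl_eq [simp]: "cl s = cl t \<longleftrightarrow> s \<^bold>= t \<in> H"
  unfolding cl_def using eq_refl eq_sym eq_trans by blast

definition rep :: "tm set \<Rightarrow> tm" where
  "rep c = (SOME t. c = cl t)"

lemma rep_cl: "rep (cl t) \<^bold>= t \<in> H"
proof -
  have "cl t = cl (rep (cl t))" unfolding rep_def by (rule someI[of _ t]) (rule refl)
  then show ?thesis by (simp only: cl_eq eq_sym)
qed

definition ext :: "var \<Rightarrow> tm set set" where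
  "ext X = {cl t | t. t \<^bold>\<in> X \<in> H}"

definition term_model :: "tm set model" where
  "term_model = \<lparr> numbers = range cl, subsets = range ext, nzero = cl Zero, none = cl One,
     nadd = (\<lambda>a b. cl (rep a \<^bold>+ rep b)), nmul = (\<lambda>a b. cl (rep a \<^bold>\<cdot> rep b)),
     nless = (\<lambda>a b. rep a \<^bold>< rep b \<in> H) \<rparr>"

lemma Add_cong: "s \<^bold>= s' \<in> H \<Longrightarrow> t \<^bold>= t' \<in> H \<Longrightarrow> s \<^bold>+ t \<^bold>= s' \<^bold>+ t' \<in> H"
proof -
  assume *: "s \<^bold>= s' \<in> H" "t \<^bold>= t' \<in> H"
  obtain x where x: "x \<notin> tvars s \<union> tvars t \<union> tvars s'"
    using ex_fresh_var[of "tvars s \<union> tvars t \<union> tvars s'"] by auto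
  then have "s \<^bold>+ t \<^bold>= s' \<^bold>+ t \<in> H"
    using Leibniz_in[OF *(1), of x "s \<^bold>+ t \<^bold>= V x \<^bold>+ t"] eq_refl by simp
  with x show ?thesis using Leibniz_in[OF *(2), of x "s \<^bold>+ t \<^bold>= s' \<^bold>+ V x"] by simp
qed

lemma Mul_cong: "s \<^bold>= s' \<in> H \<Longrightarrow> t \<^bold>= t' \<in> H \<Longrightarrow> s \<^bold>\<cdot> t \<^bold>= s' \<^bold>\<cdot> t' \<in> H"
proof -
  assume *: "s \<^bold>= s' \<in> H" "t \<^bold>= t' \<in> H"
  obtain x where x: "x \<notin> tvars s \<union> tvars t \<union> tvars s'"
    using ex_fresh_var[of "tvars s \<union> tvars t \<union> tvars s'"] by auto
  then have "s \<^bold>\<cdot> t \<^bold>= s' \<^bold>\<cdot> t \<in> H"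
    using Leibniz_in[OF *(1), of x "s \<^bold>\<cdot> t \<^bold>= V x \<^bold>\<cdot> t"] eq_refl by simp
  with x show ?thesis using Leibniz_in[OF *(2), of x "s \<^bold>\<cdot> t \<^bold>= s' \<^bold>\<cdot> V x"] by simp
qed

lemma Less_cong: "s \<^bold>= s' \<in> H \<Longrightarrow> t \<^bold>= t' \<in> H \<Longrightarrow> s \<^bold>< t \<in> H \<Longrightarrow> s' \<^bold>< t' \<in> H"
proof -
  assume *: "s \<^bold>= s' \<in> H" "t \<^bold>= t' \<in> H" "s \<^bold>< t \<in> H"
  obtain x where x: "x \<notin> tvars t \<union> tvars s'"
    using ex_fresh_var[of "tvars t \<union> tvars s'"] by auto
  then have "s' \<^bold>< t \<in> H"
    using Leibniz_in[OF *(1), of x "V x \<^bold>< t"] *(3) by simp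
  with x show ?thesis using Leibniz_in[OF *(2), of x "s' \<^bold>< V x"] by simp
qed

lemma Mem_cong: "s \<^bold>= t \<in> H \<Longrightarrow> s \<^bold>\<in> X \<in> H \<Longrightarrow> t \<^bold>\<in> X \<in> H"
  using Leibniz_in[of s t x "V x \<^bold>\<in> X"] by simp

lemma cl_in_ext [simp]: "cl t \<in> ext X \<longleftrightarrow> t \<^bold>\<in> X \<in> H"
proof
  assume "cl t \<in> ext X"
  then obtain s where "s \<^bold>= t \<in> H" "s \<^bold>\<in> X \<in> H" unfolding ext_def using eq_sym by auto
  then show "t \<^bold>\<in> X \<in> H" by (rule Mem_cong)
qed (auto simp: ext_def simp del: cl_eq)

abbreviation e0 :: "var \<Rightarrow> tm set" where "e0 \<equiv> \<lambda>x. cl (V x)"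

lemma tval_term_model: "tval term_model e0 t = cl t"
  by (induction t) (auto simp: term_model_def intro!: Add_cong Mul_cong rep_cl)

text \<open>"No z equals t" cannot lie in H, since its instance at t contradicts reflexivity. Hence
  the witness property supplies a variable equal to t, and it can be chosen outside F.\<close>

lemma ex_var_eq:
  assumes "finite F"
  shows "\<exists>y. y \<notin> F \<and> cl t = cl (V y)"
proof -
  obtain z where z: "z \<notin> tvars t" using ex_fresh_var[of "tvars t"] by auto
  have "AllN z (\<^bold>\<not> V z \<^bold>= t) \<notin> H"
    using AllN_inD[of z "\<^bold>\<not> V z \<^bold>= t" t] z eq_refl[of t] by (auto simp: Neg_def)
  then obtain y where "y \<notin> F" "\<^bold>\<not> substN z (V y) (\<^bold>\<not> V z \<^bold>= t) \<in> H"
    using witnessN[of z "\<^bold>\<not> V z \<^bold>= t" F] assms by auto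
  with z show ?thesis using eq_sym by (auto simp: Neg_def)
qed

text \<open>The argument of \<open>ex_var_eq\<close> for sets. The language has no equality of sets,
  so the formula \<open>\<psi>\<close> expressing that two sets have the same members takes its
  place.\<close>

lemma ex_var_ext:
  assumes "finite F"
  shows "\<exists>Z. Z \<notin> F \<and> ext X = ext Z"
proof -
  obtain Z where Z: "Z \<noteq> X" using ex_fresh_var[of "{X}"] by auto
  define \<psi> where "\<psi> = (\<lambda>Z. AllN ''x'' (V ''x'' \<^bold>\<in> X \<^bold>\<longleftrightarrow> V ''x'' \<^bold>\<in> Z))"
  have subst: "substS Z Y (\<^bold>\<not> \<psi> Z) = \<^bold>\<not> \<psi> Y" and free: "free_forS Y Z (\<^bold>\<not> \<psi> Z)" for Y
    using Z by (simp_all add: \<psi>_def Neg_def Iff_def And_def)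
  \<comment> \<open>Were this universal formula missing from H, the witness property would put the
    negation of a propositional tautology into H.\<close>
  have "\<psi> X \<in> H"
    using witnessN[of "''x''" "V ''x'' \<^bold>\<in> X \<^bold>\<longleftrightarrow> V ''x'' \<^bold>\<in> X" "{}"]
    by (auto simp: \<psi>_def Iff_def And_def Neg_def)
  then have "AllS Z (\<^bold>\<not> \<psi> Z) \<notin> H"
    using AllS_inD[OF _ free, of X] subst[of X] by auto
  then obtain Y where "Y \<notin> F" "\<psi> Y \<in> H"
    using witnessS[of Z "\<^bold>\<not> \<psi> Z" F] assms subst by auto
  then have "t \<^bold>\<in> X \<in> H \<longleftrightarrow> t \<^bold>\<in> Y \<in> H" for t
    using AllN_inD[of "''x''" "V ''x'' \<^bold>\<in> X \<^bold>\<longleftrightarrow> V ''x'' \<^bold>\<in> Y" t]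
    by (auto simp: \<psi>_def Iff_def And_def Neg_def)
  with \<open>Y \<notin> F\<close> show ?thesis unfolding ext_def by auto
qed

text \<open>In the quantifier cases an arbitrary element is first named by a variable outside
  \<open>vars \<psi>\<close>, so that substituting it is free of capture and the induction
  hypothesis applies to the result. The converse directions use the witness properties of H.\<close>

lemma truth: "\<phi> \<in> H \<longleftrightarrow> sat term_model e0 ext \<phi>"
proof (induction \<phi> rule: measure_induct_rule[of rank])
  case (less \<phi>)
  show ?case
  proof (cases \<phi>)
    case (Less s t)
    have "rep (cl s) \<^bold>< rep (cl t) \<in> H \<longleftrightarrow> s \<^bold>< t \<in> H"
      using Less_cong rep_cl eq_sym by meson
    with Less show ?thesis using tval_term_model by (simp add: term_model_def)
  next
    case (AllN x \<psi>)
    have sub: "substN x (V y) \<psi> \<in> H \<longleftrightarrow> sat term_model (e0(x := e0 y)) ext \<psi>" if "y \<notin> vars \<psi>" for y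
      using less[of "substN x (V y) \<psi>"] AllN sat_substN[OF free_forN_fresh[OF that]] by simp
    show ?thesis
    proof
      assume *: "\<phi> \<in> H"
      have "sat term_model (e0(x := cl t)) ext \<psi>" for t
      proof -
        obtain y where y: "y \<notin> vars \<psi>" "cl t = cl (V y)" using ex_var_eq[of "vars \<psi>"] by auto
        have "substN x (V y) \<psi> \<in> H" using AllN_inD[OF *[unfolded AllN]] free_forN_fresh[OF y(1)] .
        with sub[OF y(1)] y(2) show ?thesis by (simp del: cl_eq)
      qed
      then show "sat term_model e0 ext \<phi>" by (auto simp: AllN term_model_def)
    next
      assume *: "sat term_model e0 ext \<phi>"
      show "\<phi> \<in> H"
      proof (rule ccontr)
        assume "\<phi> \<notin> H"
        then obtain y where y: "y \<notin> vars \<psi>" "substN x (V y) \<psi> \<notin> H"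
          using witnessN[of x \<psi> "vars \<psi>"] AllN by auto
        moreover have "sat term_model (e0(x := e0 y)) ext \<psi>"
          using * by (auto simp: AllN term_model_def)
        ultimately show False using sub by simp
      qed
    qed
  next
    case (AllS X \<psi>)
    have sub: "substS X Y \<psi> \<in> H \<longleftrightarrow> sat term_model e0 (ext(X := ext Y)) \<psi>" if "Y \<notin> vars \<psi>" for Y
      using less[of "substS X Y \<psi>"] AllS sat_substS[OF free_forS_fresh[OF that]] by simp
    show ?thesis
    proof
      assume *: "\<phi> \<in> H"
      have "sat term_model e0 (ext(X := ext Z)) \<psi>" for Z
      proof -
        obtain Y where Y: "Y \<notin> vars \<psi>" "ext Z = ext Y" using ex_var_ext[of "vars \<psi>"] by auto
        have "substS X Y \<psi> \<in> H" using AllS_inD[OF *[unfolded AllS]] free_forS_fresh[OF Y(1)] .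
        with sub[OF Y(1)] Y(2) show ?thesis by simp
      qed
      then show "sat term_model e0 ext \<phi>" by (auto simp: AllS term_model_def)
    next
      assume *: "sat term_model e0 ext \<phi>"
      show "\<phi> \<in> H"
      proof (rule ccontr)
        assume "\<phi> \<notin> H"
        then obtain Y where Y: "Y \<notin> vars \<psi>" "substS X Y \<psi> \<notin> H"
          using witnessS[of X \<psi> "vars \<psi>"] AllS by auto
        moreover have "sat term_model e0 (ext(X := ext Y)) \<psi>"
          using * by (auto simp: AllS term_model_def)
        ultimately show False using sub by simp
      qed
    qed
  qed (use less in \<open>auto simp: tval_term_model\<close>)
qed

lemma wf_term_model: "wf_model term_model"
  by (auto simp: wf_model_def term_model_def ext_def)

lemma valid_term_model:
  assumes "T \<turnstile> \<phi>"
  shows "valid term_model \<phi>"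
  unfolding valid_def
proof (intro allI impI)
  fix e :: "var \<Rightarrow> tm set" and E :: "var \<Rightarrow> tm set set"
  assume e: "\<forall>x. e x \<in> numbers term_model" and E: "\<forall>X. E X \<in> subsets term_model"
  obtain xs where xs: "set xs = vars \<phi>" using finite_list[OF finite_vars] by auto
  \<comment> \<open>Off \<open>xs\<close> the assignments have to coincide with those of the truth
    lemma, because the closure quantifies over \<open>xs\<close> only. On \<open>xs\<close>, which
    lists all variables of \<phi>, they follow the given ones.\<close>
  define e' where "e' = (\<lambda>x. if x \<in> set xs then e x else e0 x)"
  define E' where "E' = (\<lambda>X. if X \<in> set xs then E X else ext X)"
  have "T \<turnstile> foldr AllS ys \<phi>" for ys
    using assms by (induction ys) (auto intro: provable.GenS)
  then have "T \<turnstile> foldr AllN zs (foldr AllS ys \<phi>)" for ys zs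
    by (induction zs) (auto intro: provable.GenN)
  then have "sat term_model e0 ext (foldr AllN xs (foldr AllS xs \<phi>))"
    using truth provable_in by blast
  then have "sat term_model e' ext (foldr AllS xs \<phi>)"
    by (rule sat_foldr_AllN) (use e in \<open>auto simp: e'_def term_model_def\<close>)
  then have "sat term_model e' E' \<phi>"
    by (rule sat_foldr_AllS) (use E in \<open>auto simp: E'_def term_model_def\<close>)
  then show "sat term_model e E \<phi>"
    by (subst sat_cong[of _ e e' E E'])
      (use fvN_subset_vars[of \<phi>] fvS_subset_vars[of \<phi>] xs in \<open>auto simp: e'_def E'_def\<close>)
qed

end

text \<open>An assumption cannot range over types, so one type of models is fixed. The type
  \<open>tm set\<close> is enough because the countermodel is a term model.\<close>

theorem completeness:
  assumes "\<And>M :: tm set model. wf_model M \<Longrightarrow> (\<And>\<psi>. \<psi> \<in> T \<Longrightarrow> valid M \<psi>) \<Longrightarrow> valid M \<phi>"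
  shows "T \<turnstile> \<phi>"
proof (rule ccontr)
  assume "\<not> T \<turnstile> \<phi>"
  then have "\<not> derives T {\<^bold>\<not> \<phi>} \<^bold>\<bottom>"
    using derives_by_contradiction[of T \<phi> "{}"] derives_empty by blast
  then obtain H where H: "henkin T H" "\<^bold>\<not> \<phi> \<in> H" by (rule ex_henkin)
  interpret henkin T H by (rule H(1))
  have "valid term_model \<phi>"
    using assms wf_term_model valid_term_model provable.Ax by blast
  then have "sat term_model e0 ext \<phi>"
    by (rule validD) (auto simp: term_model_def)
  with H(2) show False using truth by simp
qed

section \<open>Models of $\mathsf{RCA}_0$\<close>

lemma sigma00_And: "sigma00 \<phi> \<Longrightarrow> sigma00 \<psi> \<Longrightarrow> sigma00 (\<phi> \<^bold>\<and> \<psi>)"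
  by (auto simp: And_def Neg_def intro: sigma00.intros)

lemma sigma01_ExN: "sigma00 \<theta> \<Longrightarrow> sigma01 (ExN x \<theta>)"
  by (auto simp: sigma01_def)

lemmas sigma_intros = sigma01_ExN sigma00_And sigma00.intros

locale rca0_model =
  fixes \<M> :: "'a model"
  assumes wf: "wf_model \<M>"
    and axioms: "\<phi> \<in> RCA0 \<Longrightarrow> valid \<M> \<phi>"
begin

abbreviation Num :: "'a set" where "Num \<equiv> numbers \<M>"
abbreviation Sub :: "'a set set" where "Sub \<equiv> subsets \<M>"
abbreviation n0 :: 'a where "n0 \<equiv> nzero \<M>"
abbreviation n1 :: 'a where "n1 \<equiv> none \<M>"
abbreviation plus :: "'a \<Rightarrow> 'a \<Rightarrow> 'a"  (infixl "\<^bold>\<oplus>" 65) where "x \<^bold>\<oplus> y \<equiv> nadd \<M> x y"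
abbreviation less :: "'a \<Rightarrow> 'a \<Rightarrow> bool"  (infix "\<^bold>\<prec>" 50) where "x \<^bold>\<prec> y \<equiv> nless \<M> x y"

section \<open>Arithmetic in the model\<close>

lemma closed [simp]:
  "n0 \<in> Num" "n1 \<in> Num"
  "x \<in> Num \<Longrightarrow> y \<in> Num \<Longrightarrow> x \<^bold>\<oplus> y \<in> Num"
  "x \<in> Num \<Longrightarrow> y \<in> Num \<Longrightarrow> nmul \<M> x y \<in> Num"
  using wf by (auto simp: wf_model_def)

lemma Sub_subset: "X \<in> Sub \<Longrightarrow> x \<in> X \<Longrightarrow> x \<in> Num"
  using wf by (auto simp: wf_model_def)

text \<open>The assignment gives x to \<open>m\<close> and y to \<open>n\<close>, the only variables
  of the basic axioms. Some E must be supplied for validity to apply, but its choice does not affect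
  these formulas, so it stays hidden behind the quantifier.\<close>

lemma sat_basic:
  assumes "\<phi> \<in> basic_axioms" "x \<in> Num" "y \<in> Num"
  shows "\<exists>E. sat \<M> ((\<lambda>_. x)(''n'' := y)) E \<phi>"
proof -
  obtain X where "X \<in> Sub" using wf by (auto simp: wf_model_def)
  then have "sat \<M> ((\<lambda>_. x)(''n'' := y)) (\<lambda>_. X) \<phi>"
    using assms by (intro validD[OF axioms]) (auto simp: RCA0_def)
  then show ?thesis by (rule exI[of _ "\<lambda>_. X"])
qed

lemma add_0 [simp]: "x \<in> Num \<Longrightarrow> x \<^bold>\<oplus> n0 = x"
  using sat_basic[of "V ''m'' \<^bold>+ Zero \<^bold>= V ''m''" x x] by (auto simp: basic_axioms_def Let_def)

lemma add_Suc: "x \<in> Num \<Longrightarrow> y \<in> Num \<Longrightarrow> x \<^bold>\<oplus> (y \<^bold>\<oplus> n1) = (x \<^bold>\<oplus> y) \<^bold>\<oplus> n1"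
  using sat_basic[of "V ''m'' \<^bold>+ (V ''n'' \<^bold>+ One) \<^bold>= (V ''m'' \<^bold>+ V ''n'') \<^bold>+ One" x y]
  by (auto simp: basic_axioms_def Let_def)

lemma less_Suc: "x \<in> Num \<Longrightarrow> y \<in> Num \<Longrightarrow> x \<^bold>\<prec> y \<^bold>\<oplus> n1 \<longleftrightarrow> x \<^bold>\<prec> y \<or> x = y"
  using sat_basic[of "V ''m'' \<^bold>< V ''n'' \<^bold>+ One \<^bold>\<longleftrightarrow> V ''m'' \<^bold>< V ''n'' \<^bold>\<or> V ''m'' \<^bold>= V ''n''" x y]
  by (auto simp: basic_axioms_def Let_def)

text \<open>The induction scheme in semantic form: by the substitution lemma, replacing n in the
  formula becomes changing the value of n. All later inductions over \<open>Num\<close> rest on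
  it.\<close>

lemma sigma01_induct:
  assumes "sigma01 \<phi>" "free_forN Zero n \<phi>" "free_forN (V n \<^bold>+ One) n \<phi>"
    and e: "\<And>x. e x \<in> Num" and E: "\<And>X. E X \<in> Sub"
    and base: "sat \<M> (e(n := n0)) E \<phi>"
    and step: "\<And>k. k \<in> Num \<Longrightarrow> sat \<M> (e(n := k)) E \<phi> \<Longrightarrow> sat \<M> (e(n := k \<^bold>\<oplus> n1)) E \<phi>"
    and "k \<in> Num"
  shows "sat \<M> (e(n := k)) E \<phi>"
proof -
  let ?\<psi> = "substN n Zero \<phi> \<^bold>\<and> AllN n (\<phi> \<^bold>\<longrightarrow> substN n (V n \<^bold>+ One) \<phi>) \<^bold>\<longrightarrow> AllN n \<phi>"
  have "?\<psi> \<in> RCA0"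
    using assms(1) by (auto simp: RCA0_def sigma01_induction_def)
  then have "sat \<M> e E ?\<psi>" using e E by (intro validD[OF axioms])
  then show ?thesis
    using base step \<open>k \<in> Num\<close>
    by (simp add: sat_substN[OF assms(2)] sat_substN[OF assms(3)] fun_upd_same del: fun_upd_apply)
qed

text \<open>\<open>sigma01\<close> literally requires a leading existential quantifier. A vacuous
  one over \<open>d\<close> supplies it and is harmless because \<open>Num\<close> is not empty.
  With no set variables in \<phi>, E may be exchanged for a constant assignment taken from the
  model.\<close>

lemma open_induct:
  assumes "sigma00 \<phi>" "free_forN Zero ''k'' \<phi>" "free_forN (V ''k'' \<^bold>+ One) ''k'' \<phi>"
    "''d'' \<notin> fvN \<phi>" "fvS \<phi> = {}" "\<And>x. e x \<in> Num"
    and base: "sat \<M> (e(''k'' := n0)) E \<phi>"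
    and step: "\<And>k. k \<in> Num \<Longrightarrow> sat \<M> (e(''k'' := k)) E \<phi> \<Longrightarrow> sat \<M> (e(''k'' := k \<^bold>\<oplus> n1)) E \<phi>"
    and "k \<in> Num"
  shows "sat \<M> (e(''k'' := k)) E \<phi>"
proof -
  obtain X where X: "X \<in> Sub" using wf by (auto simp: wf_model_def)
  have dummy: "sat \<M> e' (\<lambda>_. X) (ExN ''d'' \<phi>) \<longleftrightarrow> sat \<M> e' E \<phi>" for e'
  proof -
    have "sat \<M> (e'(''d'' := d)) (\<lambda>_. X) \<phi> \<longleftrightarrow> sat \<M> e' E \<phi>" for d
      using assms(4,5) by (intro sat_cong) auto
    moreover have "\<exists>d. d \<in> Num" using closed(1) by blast
    ultimately show ?thesis by (simp del: fun_upd_apply)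
  qed
  have "sat \<M> (e(''k'' := k)) (\<lambda>_. X) (ExN ''d'' \<phi>)"
  proof (rule sigma01_induct)
    show "sigma01 (ExN ''d'' \<phi>)" using assms(1) by (rule sigma01_ExN)
    show "free_forN Zero ''k'' (ExN ''d'' \<phi>)" "free_forN (V ''k'' \<^bold>+ One) ''k'' (ExN ''d'' \<phi>)"
      using assms(2,3) by (simp_all add: ExN_def Neg_def)
  qed (unfold dummy, use X assms in \<open>auto simp del: fun_upd_apply\<close>)
  then show ?thesis by (simp only: dummy)
qed

lemma zero_add: "k \<in> Num \<Longrightarrow> n0 \<^bold>\<oplus> k = k"
  using open_induct[of "Zero \<^bold>+ V ''k'' \<^bold>= V ''k''" "\<lambda>_. n0" undefined k]
  by (simp add: sigma_intros add_Suc)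

lemma Suc_add:
  assumes "x \<in> Num" "k \<in> Num" shows "(x \<^bold>\<oplus> n1) \<^bold>\<oplus> k = (x \<^bold>\<oplus> k) \<^bold>\<oplus> n1"
  using open_induct[of "(V ''x'' \<^bold>+ One) \<^bold>+ V ''k'' \<^bold>= (V ''x'' \<^bold>+ V ''k'') \<^bold>+ One" "\<lambda>_. x" undefined k]
    assms
  by (simp add: sigma_intros add_Suc)

lemma add_commute:
  assumes "x \<in> Num" "k \<in> Num" shows "x \<^bold>\<oplus> k = k \<^bold>\<oplus> x"
  using open_induct[of "V ''x'' \<^bold>+ V ''k'' \<^bold>= V ''k'' \<^bold>+ V ''x''" "\<lambda>_. x" undefined k] assms
  by (simp add: sigma_intros add_Suc zero_add Suc_add)

lemma less_add:
  assumes "x \<in> Num" "y \<in> Num" "k \<in> Num" "x \<^bold>\<prec> y" shows "x \<^bold>\<prec> y \<^bold>\<oplus> k"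
  using open_induct[of "V ''x'' \<^bold>< V ''y'' \<^bold>+ V ''k''" "(\<lambda>_. x)(''y'' := y)" undefined k] assms
  by (simp add: sigma_intros add_Suc less_Suc)

text \<open>F is finite in the sense of HOL, so ordinary induction applies. Adding bounds stands in
  for taking a maximum: \<open>less_add\<close> and commutativity show that the sum of b and x + 1
  exceeds both x and everything below b.\<close>

lemma ex_upper_bound:
  assumes "finite F" "F \<subseteq> Num"
  shows "\<exists>b\<in>Num. \<forall>x\<in>F. x \<^bold>\<prec> b"
  using assms
proof (induction F rule: finite_induct)
  case empty
  show ?case using closed(1) by blast
next
  case (insert x F)
  then obtain b where b: "b \<in> Num" "\<forall>x\<in>F. x \<^bold>\<prec> b" by auto
  have "x \<^bold>\<prec> (x \<^bold>\<oplus> n1) \<^bold>\<oplus> b"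
    using less_add[of x "x \<^bold>\<oplus> n1" b] insert.prems b(1) by (simp add: less_Suc)
  then have "x \<^bold>\<prec> b \<^bold>\<oplus> (x \<^bold>\<oplus> n1)"
    using insert.prems b(1) add_commute by simp
  moreover have "\<forall>y\<in>F. y \<^bold>\<prec> b \<^bold>\<oplus> (x \<^bold>\<oplus> n1)"
    using insert.prems b by (auto intro: less_add)
  ultimately show ?case using insert.prems b(1) by (intro bexI[of _ "b \<^bold>\<oplus> (x \<^bold>\<oplus> n1)"]) auto
qed

section \<open>Evaluating pairs, operations and relativized quantifiers\<close>

definition pr :: "'a \<Rightarrow> 'a \<Rightarrow> 'a" where
  "pr x y = nmul \<M> (x \<^bold>\<oplus> y) (x \<^bold>\<oplus> y) \<^bold>\<oplus> x"

lemma tval_pair [simp]: "tval \<M> e (pair s t) = pr (tval \<M> e s) (tval \<M> e t)"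
  by (simp add: pair_def pr_def)

definition op :: "'a set \<Rightarrow> 'a \<Rightarrow> 'a \<Rightarrow> 'a \<Rightarrow> bool" where
  "op F x y u \<longleftrightarrow> pr (pr x y) u \<in> F"

lemma sat_app2 [simp]: "sat \<M> e E (app2 F s t u) \<longleftrightarrow> op (E F) (tval \<M> e s) (tval \<M> e t) (tval \<M> e u)"
  by (simp add: app2_def op_def)

text \<open>The premise puts all members of \<open>E X\<close> into \<open>Num\<close>, so a number
  quantifier relativized to X becomes a quantifier over \<open>E X\<close>.\<close>

lemma sat_All_in [simp]:
  "sat \<M> e E (All_in [] X \<phi>) \<longleftrightarrow> sat \<M> e E \<phi>"
  "E X \<in> Sub \<Longrightarrow> sat \<M> e E (All_in (x # xs) X \<phi>) \<longleftrightarrow> (\<forall>d\<in>E X. sat \<M> (e(x := d)) E (All_in xs X \<phi>))"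
  by (auto simp: All_in_def intro: Sub_subset)

lemma sat_Ex_in [simp]:
  "sat \<M> e E (Ex_in [] X \<phi>) \<longleftrightarrow> sat \<M> e E \<phi>"
  "E X \<in> Sub \<Longrightarrow> sat \<M> e E (Ex_in (x # xs) X \<phi>) \<longleftrightarrow> (\<exists>d\<in>E X. sat \<M> (e(x := d)) E (Ex_in xs X \<phi>))"
  by (auto simp: Ex_in_def intro: Sub_subset)

end


section \<open>Rings inside a model\<close>

text \<open>The assumptions are worded as the simplifier leaves \<open>sat\<close> of
  \<open>comm_ring\<close>, so that \<open>rca0_ringI\<close> can discharge the axioms by
  assumption.\<close>

locale rca0_ring = rca0_model +
  fixes R A M :: "'a set" and rzero rone :: 'a
  assumes Sub [simp]: "R \<in> Sub" "A \<in> Sub" "M \<in> Sub"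
    and const [simp]: "rzero \<in> R" "rone \<in> R"
    and A_ex: "\<forall>x\<in>R. \<forall>y\<in>R. \<exists>u\<in>R. op A x y u \<and> (\<forall>v\<in>R. op A x y v \<longrightarrow> v = u)"
    and M_ex: "\<forall>x\<in>R. \<forall>y\<in>R. \<exists>u\<in>R. op M x y u \<and> (\<forall>v\<in>R. op M x y v \<longrightarrow> v = u)"
    and A_assoc: "\<forall>x\<in>R. \<forall>y\<in>R. \<forall>z\<in>R. \<forall>u\<in>R. \<forall>v\<in>R. \<forall>w\<in>R. \<forall>p\<in>R.
      op A x y u \<and> op A u z v \<and> op A y z w \<and> op A x w p \<longrightarrow> v = p"
    and A_comm: "\<forall>x\<in>R. \<forall>y\<in>R. \<forall>u\<in>R. op A x y u \<longrightarrow> op A y x u"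
    and A_zero: "\<forall>x\<in>R. op A x rzero x"
    and A_inv: "\<forall>x\<in>R. \<exists>y\<in>R. op A x y rzero"
    and M_assoc: "\<forall>x\<in>R. \<forall>y\<in>R. \<forall>z\<in>R. \<forall>u\<in>R. \<forall>v\<in>R. \<forall>w\<in>R. \<forall>p\<in>R.
      op M x y u \<and> op M u z v \<and> op M y z w \<and> op M x w p \<longrightarrow> v = p"
    and M_comm: "\<forall>x\<in>R. \<forall>y\<in>R. \<forall>u\<in>R. op M x y u \<longrightarrow> op M y x u"
    and M_one: "\<forall>x\<in>R. op M x rone x"
    and distrib: "\<forall>x\<in>R. \<forall>y\<in>R. \<forall>z\<in>R. \<forall>u\<in>R. \<forall>v\<in>R. \<forall>p\<in>R. \<forall>q\<in>R. \<forall>w\<in>R.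
      op A y z u \<and> op M x u v \<and> op M x y p \<and> op M x z q \<and> op A p q w \<longrightarrow> v = w"

lemma (in rca0_model) rca0_ringI:
  assumes "sat \<M> e E comm_ring" and [simp]: "\<And>X. E X \<in> Sub"
  shows "rca0_ring \<M> (E ''R'') (E ''A'') (E ''M'') (e ''zero'') (e ''one'')"
proof -
  note ring = assms(1)[unfolded comm_ring_def binary_operation_def Let_def, simplified]
  show ?thesis
    by unfold_locales ((rule assms(2))+, (insert ring, elim conjE, assumption)+)
qed

section \<open>The coded ring as a commutative ring of HOL\<close>

context rca0_ring
begin

text \<open>Definite descriptions turn the graphs of the operations into functions, which makes ring
  identities accessible to the \<open>algebra\<close> method.\<close>

definition ring_of :: "'a ring" ("\<R>") where
  "\<R> = \<lparr> carrier = R, mult = (\<lambda>x y. THE u. u \<in> R \<and> op M x y u), one = rone, zero = rzero,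
     add = (\<lambda>x y. THE u. u \<in> R \<and> op A x y u) \<rparr>"

lemma ring_of_simps [simp]: "carrier \<R> = R" "\<one>\<^bsub>\<R>\<^esub> = rone" "\<zero>\<^bsub>\<R>\<^esub> = rzero"
  by (simp_all add: ring_of_def)

lemma op_A_iff:
  assumes "x \<in> R" "y \<in> R"
  shows "x \<oplus>\<^bsub>\<R>\<^esub> y \<in> R" "u \<in> R \<Longrightarrow> op A x y u \<longleftrightarrow> u = x \<oplus>\<^bsub>\<R>\<^esub> y"
proof -
  have *: "\<exists>!u. u \<in> R \<and> op A x y u" using A_ex assms by blast
  have sum: "x \<oplus>\<^bsub>\<R>\<^esub> y = (THE u. u \<in> R \<and> op A x y u)" by (simp add: ring_of_def)
  have **: "x \<oplus>\<^bsub>\<R>\<^esub> y \<in> R \<and> op A x y (x \<oplus>\<^bsub>\<R>\<^esub> y)" unfolding sum by (rule theI'[OF *])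
  then show "x \<oplus>\<^bsub>\<R>\<^esub> y \<in> R" ..
  show "op A x y u \<longleftrightarrow> u = x \<oplus>\<^bsub>\<R>\<^esub> y" if "u \<in> R" using * ** that by blast
qed

lemma op_M_iff:
  assumes "x \<in> R" "y \<in> R"
  shows "x \<otimes>\<^bsub>\<R>\<^esub> y \<in> R" "u \<in> R \<Longrightarrow> op M x y u \<longleftrightarrow> u = x \<otimes>\<^bsub>\<R>\<^esub> y"
proof -
  have *: "\<exists>!u. u \<in> R \<and> op M x y u" using M_ex assms by blast
  have prod: "x \<otimes>\<^bsub>\<R>\<^esub> y = (THE u. u \<in> R \<and> op M x y u)" by (simp add: ring_of_def)
  have **: "x \<otimes>\<^bsub>\<R>\<^esub> y \<in> R \<and> op M x y (x \<otimes>\<^bsub>\<R>\<^esub> y)" unfolding prod by (rule theI'[OF *])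
  then show "x \<otimes>\<^bsub>\<R>\<^esub> y \<in> R" ..
  show "op M x y u \<longleftrightarrow> u = x \<otimes>\<^bsub>\<R>\<^esub> y" if "u \<in> R" using * ** that by blast
qed

lemma A_comm_fun: "x \<in> R \<Longrightarrow> y \<in> R \<Longrightarrow> x \<oplus>\<^bsub>\<R>\<^esub> y = y \<oplus>\<^bsub>\<R>\<^esub> x"
  using A_comm[rule_format, of x y "x \<oplus>\<^bsub>\<R>\<^esub> y"] by (simp add: op_A_iff)

lemma M_comm_fun: "x \<in> R \<Longrightarrow> y \<in> R \<Longrightarrow> x \<otimes>\<^bsub>\<R>\<^esub> y = y \<otimes>\<^bsub>\<R>\<^esub> x"
  using M_comm[rule_format, of x y "x \<otimes>\<^bsub>\<R>\<^esub> y"] by (simp add: op_M_iff)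

lemma distrib_fun:
  "x \<in> R \<Longrightarrow> y \<in> R \<Longrightarrow> z \<in> R \<Longrightarrow> x \<otimes>\<^bsub>\<R>\<^esub> (y \<oplus>\<^bsub>\<R>\<^esub> z) = x \<otimes>\<^bsub>\<R>\<^esub> y \<oplus>\<^bsub>\<R>\<^esub> x \<otimes>\<^bsub>\<R>\<^esub> z"
  using distrib[rule_format, of x y z "y \<oplus>\<^bsub>\<R>\<^esub> z" "x \<otimes>\<^bsub>\<R>\<^esub> (y \<oplus>\<^bsub>\<R>\<^esub> z)" "x \<otimes>\<^bsub>\<R>\<^esub> y" "x \<otimes>\<^bsub>\<R>\<^esub> z" "x \<otimes>\<^bsub>\<R>\<^esub> y \<oplus>\<^bsub>\<R>\<^esub> x \<otimes>\<^bsub>\<R>\<^esub> z"]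
  by (simp add: op_A_iff op_M_iff)

sublocale cring \<R>
proof (rule cringI)
  show "abelian_group \<R>"
  proof (rule abelian_groupI)
    fix x y z assume "x \<in> carrier \<R>" "y \<in> carrier \<R>" "z \<in> carrier \<R>"
    then show "x \<oplus>\<^bsub>\<R>\<^esub> y \<oplus>\<^bsub>\<R>\<^esub> z = x \<oplus>\<^bsub>\<R>\<^esub> (y \<oplus>\<^bsub>\<R>\<^esub> z)"
      using A_assoc[rule_format, of x y z "x \<oplus>\<^bsub>\<R>\<^esub> y" "x \<oplus>\<^bsub>\<R>\<^esub> y \<oplus>\<^bsub>\<R>\<^esub> z" "y \<oplus>\<^bsub>\<R>\<^esub> z" "x \<oplus>\<^bsub>\<R>\<^esub> (y \<oplus>\<^bsub>\<R>\<^esub> z)"]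
      by (simp add: op_A_iff)
  next
    fix x assume x: "x \<in> carrier \<R>"
    then show "\<zero>\<^bsub>\<R>\<^esub> \<oplus>\<^bsub>\<R>\<^esub> x = x"
      using A_zero[rule_format, of x] A_comm_fun[of rzero x] by (simp add: op_A_iff)
    obtain y where "y \<in> R" "op A x y rzero" using A_inv x by auto
    then show "\<exists>y\<in>carrier \<R>. y \<oplus>\<^bsub>\<R>\<^esub> x = \<zero>\<^bsub>\<R>\<^esub>"
      using x A_comm_fun[of x y] by (intro bexI[of _ y]) (simp_all add: op_A_iff)
  qed (simp_all add: op_A_iff A_comm_fun)
  show "comm_monoid \<R>"
  proof (rule comm_monoidI)
    fix x y z assume "x \<in> carrier \<R>" "y \<in> carrier \<R>" "z \<in> carrier \<R>"
    then show "x \<otimes>\<^bsub>\<R>\<^esub> y \<otimes>\<^bsub>\<R>\<^esub> z = x \<otimes>\<^bsub>\<R>\<^esub> (y \<otimes>\<^bsub>\<R>\<^esub> z)"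
      using M_assoc[rule_format, of x y z "x \<otimes>\<^bsub>\<R>\<^esub> y" "x \<otimes>\<^bsub>\<R>\<^esub> y \<otimes>\<^bsub>\<R>\<^esub> z" "y \<otimes>\<^bsub>\<R>\<^esub> z" "x \<otimes>\<^bsub>\<R>\<^esub> (y \<otimes>\<^bsub>\<R>\<^esub> z)"]
      by (simp add: op_M_iff)
  next
    fix x assume "x \<in> carrier \<R>"
    then show "\<one>\<^bsub>\<R>\<^esub> \<otimes>\<^bsub>\<R>\<^esub> x = x"
      using M_one[rule_format, of x] M_comm_fun[of rone x] by (simp add: op_M_iff)
  qed (simp_all add: op_M_iff M_comm_fun)
  fix x y z assume "x \<in> carrier \<R>" "y \<in> carrier \<R>" "z \<in> carrier \<R>"
  then show "(x \<oplus>\<^bsub>\<R>\<^esub> y) \<otimes>\<^bsub>\<R>\<^esub> z = x \<otimes>\<^bsub>\<R>\<^esub> z \<oplus>\<^bsub>\<R>\<^esub> y \<otimes>\<^bsub>\<R>\<^esub> z"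
    using distrib_fun[of z x y] M_comm_fun[of "x \<oplus>\<^bsub>\<R>\<^esub> y" z] M_comm_fun[of x z] M_comm_fun[of y z]
    by (simp add: op_A_iff)
qed


lemma op_simps [simp]:
  assumes "x \<in> R" "y \<in> R"
  shows "op A x y (x \<oplus>\<^bsub>\<R>\<^esub> y)" "op M x y (x \<otimes>\<^bsub>\<R>\<^esub> y)" "x \<oplus>\<^bsub>\<R>\<^esub> y \<in> R" "x \<otimes>\<^bsub>\<R>\<^esub> y \<in> R"
  using assms by (simp_all add: op_A_iff op_M_iff)

section \<open>Sequences of powers and the inductions on exponents\<close>

definition power_seq :: "'a \<Rightarrow> 'a set \<Rightarrow> bool" where
  "power_seq a P \<longleftrightarrow> P \<in> Sub \<and> (\<forall>w\<in>Num. w \<in> P \<longrightarrow> (\<exists>k\<in>Num. \<exists>u\<in>R. w = pr k u)) \<and>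
    (\<forall>k\<in>Num. \<exists>u\<in>R. pr k u \<in> P \<and> (\<forall>v\<in>R. pr k v \<in> P \<longrightarrow> v = u)) \<and> pr n0 rone \<in> P \<and>
    (\<forall>k\<in>Num. \<forall>u\<in>R. \<forall>v\<in>R. pr k u \<in> P \<and> op M u a v \<longrightarrow> pr (k \<^bold>\<oplus> n1) v \<in> P)"

lemma power_seq_0: "power_seq a P \<Longrightarrow> pr n0 rone \<in> P"
  by (simp add: power_seq_def)

lemma power_seq_Suc:
  "power_seq a P \<Longrightarrow> a \<in> R \<Longrightarrow> k \<in> Num \<Longrightarrow> u \<in> R \<Longrightarrow> pr k u \<in> P \<Longrightarrow> pr (k \<^bold>\<oplus> n1) (u \<otimes>\<^bsub>\<R>\<^esub> a) \<in> P"
  by (simp add: power_seq_def)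

lemma power_seq_unique:
  "power_seq a P \<Longrightarrow> k \<in> Num \<Longrightarrow> u \<in> R \<Longrightarrow> v \<in> R \<Longrightarrow> pr k u \<in> P \<Longrightarrow> pr k v \<in> P \<Longrightarrow> u = v"
  unfolding power_seq_def by (elim conjE) metis

lemma power_seq_Sub: "power_seq a P \<Longrightarrow> P \<in> Sub"
  by (simp add: power_seq_def)

lemma R_Num [simp]: "x \<in> R \<Longrightarrow> x \<in> Num"
  by (rule Sub_subset[OF Sub(1)])

text \<open>Multiply the equation for \<open>k\<close> by $1 = a + jc$: the product of $a$ with anything is absorbed
  by the second summand. All five witnesses are bounded by one number, so that the induction
  hypothesis is $\Sigma^0_1$.\<close>

lemma comaximal_power:
  assumes P: "power_seq j P" and R: "a \<in> R" "j \<in> R" "c \<in> R"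
    and eq: "rone = a \<oplus>\<^bsub>\<R>\<^esub> j \<otimes>\<^bsub>\<R>\<^esub> c" and k: "k \<in> Num"
  shows "\<exists>p\<in>R. \<exists>d\<in>R. \<exists>e\<in>R. pr k p \<in> P \<and> rone = p \<otimes>\<^bsub>\<R>\<^esub> d \<oplus>\<^bsub>\<R>\<^esub> a \<otimes>\<^bsub>\<R>\<^esub> e"
proof -
  define B where "B x \<phi> = ExN x (V x \<^bold>< V ''b'' \<^bold>\<and> \<phi>)" for x \<phi>
  \<comment> \<open>The operations are coded as graphs, so intermediate results need names: f is the
    product of p and d, and g is the product of a and e.\<close>
  define \<theta> where "\<theta> = V ''p'' \<^bold>\<in> ''R'' \<^bold>\<and> V ''d'' \<^bold>\<in> ''R'' \<^bold>\<and> V ''e'' \<^bold>\<in> ''R'' \<^bold>\<and> V ''f'' \<^bold>\<in> ''R'' \<^bold>\<and> V ''g'' \<^bold>\<in> ''R'' \<^bold>\<and>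
    pair (V ''k'') (V ''p'') \<^bold>\<in> ''P'' \<^bold>\<and> prodR (V ''p'') (V ''d'') (V ''f'') \<^bold>\<and>
    prodR (V ''a'') (V ''e'') (V ''g'') \<^bold>\<and> sumR (V ''f'') (V ''g'') oneR"
  define \<phi> where "\<phi> = ExN ''b'' (B ''p'' (B ''d'' (B ''e'' (B ''f'' (B ''g'' \<theta>)))))"
  \<comment> \<open>Default values: a number variable not set explicitly, among them
    \<open>a\<close>, has the value a, and a set variable not set explicitly, among them
    \<open>R\<close>, has the value R.\<close>
  define e\<^sub>0 where "e\<^sub>0 = (\<lambda>_. a)(''one'' := rone)"
  define E where "E = (\<lambda>_. R)(''A'' := A, ''M'' := M, ''P'' := P)"
  define Q where "Q k \<longleftrightarrow> (\<exists>p\<in>R. \<exists>d\<in>R. \<exists>e\<in>R. pr k p \<in> P \<and> rone = p \<otimes>\<^bsub>\<R>\<^esub> d \<oplus>\<^bsub>\<R>\<^esub> a \<otimes>\<^bsub>\<R>\<^esub> e)" for k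
  have BI: "sat \<M> e E (B x \<psi>)"
    if "sat \<M> (e(x := d)) E \<psi>" "d \<in> Num" "d \<^bold>\<prec> e ''b''" "x \<noteq> ''b''" for d e x \<psi>
    using that unfolding B_def sat_ExN by (intro bexI[of _ d]) simp_all
  have sat: "sat \<M> (e\<^sub>0(''k'' := k)) E \<phi> \<longleftrightarrow> Q k" for k
  proof
    assume "sat \<M> (e\<^sub>0(''k'' := k)) E \<phi>"
    then obtain p d e f g where "p \<in> R" "d \<in> R" "e \<in> R" "f \<in> R" "g \<in> R" "pr k p \<in> P"
        "op M p d f" "op M a e g" "op A f g rone"
      by (auto simp: \<phi>_def B_def \<theta>_def e\<^sub>0_def E_def)
    then show "Q k" unfolding Q_def using R(1) by (auto simp: op_A_iff op_M_iff)
  next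
    assume "Q k"
    then obtain p d e where *: "p \<in> R" "d \<in> R" "e \<in> R" "pr k p \<in> P"
      "rone = p \<otimes>\<^bsub>\<R>\<^esub> d \<oplus>\<^bsub>\<R>\<^esub> a \<otimes>\<^bsub>\<R>\<^esub> e" unfolding Q_def by auto
    define f g where fg: "f = p \<otimes>\<^bsub>\<R>\<^esub> d" "g = a \<otimes>\<^bsub>\<R>\<^esub> e"
    have fgR: "f \<in> R" "g \<in> R" "op M p d f" "op M a e g"
      using *(1-3) R(1) by (simp_all add: fg)
    have sum: "op A f g rone"
      using op_simps(1)[OF fgR(1,2)] *(5)[folded fg] by (rule back_subst[OF _ sym])
    obtain b where "b \<in> Num" "p \<^bold>\<prec> b" "d \<^bold>\<prec> b" "e \<^bold>\<prec> b" "f \<^bold>\<prec> b" "g \<^bold>\<prec> b"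
      using ex_upper_bound[of "{p, d, e, f, g}"] *(1-3) fgR(1,2) by auto
    note b = this
    show "sat \<M> (e\<^sub>0(''k'' := k)) E \<phi>"
      unfolding \<phi>_def sat_ExN
      by (rule bexI[of _ b], rule BI[where d = p], rule BI[where d = d], rule BI[where d = e],
          rule BI[where d = f], rule BI[where d = g])
        (use b *(1-4) fgR sum in \<open>simp_all add: \<theta>_def e\<^sub>0_def E_def\<close>)
  qed
  have "sat \<M> (e\<^sub>0(''k'' := k)) E \<phi>"
  proof (rule sigma01_induct)
    show "sigma01 \<phi>"
      unfolding \<phi>_def B_def \<theta>_def app2_def by (intro sigma_intros) simp_all
    show "free_forN Zero ''k'' \<phi>" "free_forN (V ''k'' \<^bold>+ One) ''k'' \<phi>"
      by (simp_all add: \<phi>_def B_def \<theta>_def ExN_def And_def Neg_def app2_def)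
    show "e\<^sub>0 x \<in> Num" for x using R by (simp add: e\<^sub>0_def)
    show "E X \<in> Sub" for X using P by (simp add: E_def power_seq_def)
    have "rone = rone \<otimes>\<^bsub>\<R>\<^esub> rone \<oplus>\<^bsub>\<R>\<^esub> a \<otimes>\<^bsub>\<R>\<^esub> rzero"
      using R r_null[of a] r_zero[of rone] r_one[of rone] by simp
    then show "sat \<M> (e\<^sub>0(''k'' := n0)) E \<phi>"
      unfolding sat Q_def using power_seq_0[OF P] const by blast
    fix i assume i: "i \<in> Num" "sat \<M> (e\<^sub>0(''k'' := i)) E \<phi>"
    then obtain p d e where *: "p \<in> R" "d \<in> R" "e \<in> R" "pr i p \<in> P"
      "rone = p \<otimes>\<^bsub>\<R>\<^esub> d \<oplus>\<^bsub>\<R>\<^esub> a \<otimes>\<^bsub>\<R>\<^esub> e" unfolding sat Q_def by auto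
    have "rone = (p \<otimes>\<^bsub>\<R>\<^esub> d) \<otimes>\<^bsub>\<R>\<^esub> (a \<oplus>\<^bsub>\<R>\<^esub> j \<otimes>\<^bsub>\<R>\<^esub> c) \<oplus>\<^bsub>\<R>\<^esub> a \<otimes>\<^bsub>\<R>\<^esub> e"
      unfolding eq[symmetric] using * R r_one[of "p \<otimes>\<^bsub>\<R>\<^esub> d"] by simp
    also have "\<dots> = (p \<otimes>\<^bsub>\<R>\<^esub> j) \<otimes>\<^bsub>\<R>\<^esub> (d \<otimes>\<^bsub>\<R>\<^esub> c) \<oplus>\<^bsub>\<R>\<^esub> a \<otimes>\<^bsub>\<R>\<^esub> (p \<otimes>\<^bsub>\<R>\<^esub> d \<oplus>\<^bsub>\<R>\<^esub> e)"
    proof -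
      have "a \<in> carrier \<R>" "j \<in> carrier \<R>" "c \<in> carrier \<R>" "p \<in> carrier \<R>" "d \<in> carrier \<R>" "e \<in> carrier \<R>"
        using * R by simp_all
      then show ?thesis by algebra
    qed
    finally show "sat \<M> (e\<^sub>0(''k'' := i \<^bold>\<oplus> n1)) E \<phi>"
      unfolding sat Q_def using * R power_seq_Suc[OF P R(2) i(1) *(1) *(4)]
      by (intro bexI[of _ "p \<otimes>\<^bsub>\<R>\<^esub> j"] bexI[of _ "d \<otimes>\<^bsub>\<R>\<^esub> c"] bexI[of _ "p \<otimes>\<^bsub>\<R>\<^esub> d \<oplus>\<^bsub>\<R>\<^esub> e"] conjI) simp_all
  qed (rule k)
  then show ?thesis unfolding sat Q_def .
qed


text \<open>Quantified over v, the claim is universal and not of the form \<open>sigma01\<close>.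
  The induction therefore shows that P and P' have some value at k in common, and uniqueness of
  values in P identifies it with v.\<close>

lemma power_seq_subset:
  assumes P: "power_seq a P" and P': "power_seq a P'" and "a \<in> R" "k \<in> Num" "v \<in> R" "pr k v \<in> P"
  shows "pr k v \<in> P'"
proof -
  define \<phi> where "\<phi> = ExN ''u'' (V ''u'' \<^bold>\<in> ''R'' \<^bold>\<and> pair (V ''k'') (V ''u'') \<^bold>\<in> ''P'' \<^bold>\<and> pair (V ''k'') (V ''u'') \<^bold>\<in> ''Q'')"
  define E where "E = (\<lambda>_. R)(''P'' := P, ''Q'' := P')"
  have sat: "sat \<M> ((\<lambda>_. a)(''k'' := k)) E \<phi> \<longleftrightarrow> (\<exists>u\<in>R. pr k u \<in> P \<and> pr k u \<in> P')" for k
    by (auto simp: \<phi>_def E_def)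
  have "sat \<M> ((\<lambda>_. a)(''k'' := k)) E \<phi>"
  proof (rule sigma01_induct)
    show "sigma01 \<phi>" unfolding \<phi>_def by (intro sigma_intros)
    show "free_forN Zero ''k'' \<phi>" "free_forN (V ''k'' \<^bold>+ One) ''k'' \<phi>"
      by (simp_all add: \<phi>_def ExN_def And_def Neg_def)
    show "E X \<in> Sub" for X using power_seq_Sub[OF P] power_seq_Sub[OF P'] by (simp add: E_def)
    show "sat \<M> ((\<lambda>_. a)(''k'' := n0)) E \<phi>"
      unfolding sat using power_seq_0[OF P] power_seq_0[OF P'] const(2) by blast
    show "sat \<M> ((\<lambda>_. a)(''k'' := i \<^bold>\<oplus> n1)) E \<phi>"
      if i: "i \<in> Num" "sat \<M> ((\<lambda>_. a)(''k'' := i)) E \<phi>" for i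
      using i(2) power_seq_Suc[OF P \<open>a \<in> R\<close> i(1)] power_seq_Suc[OF P' \<open>a \<in> R\<close> i(1)] op_simps(4) \<open>a \<in> R\<close>
      unfolding sat by blast
  qed (use assms in simp_all)
  then obtain u where "u \<in> R" "pr k u \<in> P" "pr k u \<in> P'" unfolding sat by auto
  then show ?thesis using power_seq_unique[OF P] assms by metis
qed

section \<open>Ideals and radicals in the model\<close>

definition is_ideal :: "'a set \<Rightarrow> bool" where
  "is_ideal I \<longleftrightarrow> I \<in> Sub \<and> (\<forall>x\<in>Num. x \<in> I \<longrightarrow> x \<in> R) \<and> rzero \<in> I \<and>
    (\<forall>x\<in>R. \<forall>y\<in>R. \<forall>u\<in>R. x \<in> I \<and> y \<in> I \<and> op A x y u \<longrightarrow> u \<in> I) \<and>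
    (\<forall>x\<in>R. \<forall>y\<in>R. \<forall>u\<in>R. y \<in> I \<and> op M x y u \<longrightarrow> u \<in> I)"

lemma ideal_mult: "is_ideal I \<Longrightarrow> x \<in> R \<Longrightarrow> y \<in> R \<Longrightarrow> y \<in> I \<Longrightarrow> x \<otimes>\<^bsub>\<R>\<^esub> y \<in> I"
  unfolding is_ideal_def using op_simps(2,4)[of x y] by metis

lemma ideal_Sub: "is_ideal I \<Longrightarrow> I \<in> Sub"
  unfolding is_ideal_def by (rule conjunct1)

text \<open>The exponents witnessing the two radicals differ, and this raises either of them to
  their sum: starting from n, each of the k steps multiplies by a and stays in the ideal.\<close>

lemma ideal_power_add:
  assumes P: "power_seq a P" and I: "is_ideal I"
    and "a \<in> R" "n \<in> Num" "v \<in> R" "pr n v \<in> P" "v \<in> I" "k \<in> Num"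
  shows "\<exists>u\<in>R. pr (n \<^bold>\<oplus> k) u \<in> P \<and> u \<in> I"
proof -
  define \<phi> where "\<phi> = ExN ''u'' (V ''u'' \<^bold>\<in> ''R'' \<^bold>\<and> pair (V ''n'' \<^bold>+ V ''k'') (V ''u'') \<^bold>\<in> ''P'' \<^bold>\<and> V ''u'' \<^bold>\<in> ''I'')"
  define E where "E = (\<lambda>_. R)(''P'' := P, ''I'' := I)"
  have sat: "sat \<M> ((\<lambda>_. n)(''k'' := k)) E \<phi> \<longleftrightarrow> (\<exists>u\<in>R. pr (n \<^bold>\<oplus> k) u \<in> P \<and> u \<in> I)" for k
    by (auto simp: \<phi>_def E_def)
  have "sat \<M> ((\<lambda>_. n)(''k'' := k)) E \<phi>"
  proof (rule sigma01_induct)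
    show "sigma01 \<phi>" unfolding \<phi>_def by (intro sigma_intros)
    show "free_forN Zero ''k'' \<phi>" "free_forN (V ''k'' \<^bold>+ One) ''k'' \<phi>"
      by (simp_all add: \<phi>_def ExN_def And_def Neg_def)
    show "E X \<in> Sub" for X using power_seq_Sub[OF P] ideal_Sub[OF I] by (simp add: E_def)
    show "sat \<M> ((\<lambda>_. n)(''k'' := n0)) E \<phi>"
      unfolding sat add_0[OF \<open>n \<in> Num\<close>] using assms(5-7) by blast
    fix i assume i: "i \<in> Num" "sat \<M> ((\<lambda>_. n)(''k'' := i)) E \<phi>"
    then obtain u where u: "u \<in> R" "pr (n \<^bold>\<oplus> i) u \<in> P" "u \<in> I" unfolding sat by auto
    have "pr ((n \<^bold>\<oplus> i) \<^bold>\<oplus> n1) (u \<otimes>\<^bsub>\<R>\<^esub> a) \<in> P"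
      by (rule power_seq_Suc[OF P]) (use assms i u in simp_all)
    moreover have "u \<otimes>\<^bsub>\<R>\<^esub> a \<in> I"
      using ideal_mult[OF I \<open>a \<in> R\<close> u(1,3)] M_comm_fun[OF \<open>a \<in> R\<close> u(1)] by simp
    ultimately show "sat \<M> ((\<lambda>_. n)(''k'' := i \<^bold>\<oplus> n1)) E \<phi>"
      unfolding sat using add_Suc[OF \<open>n \<in> Num\<close> i(1)] u(1) \<open>a \<in> R\<close>
      by (intro bexI[of _ "u \<otimes>\<^bsub>\<R>\<^esub> a"]) simp_all
  qed (use assms in simp_all)
  then show ?thesis unfolding sat .
qed

definition in_radical :: "'a set \<Rightarrow> 'a \<Rightarrow> bool" where
  "in_radical I a \<longleftrightarrow> a \<in> R \<and>
    (\<exists>n\<in>Num. n0 \<^bold>\<prec> n \<and> (\<exists>P\<in>Sub. power_seq a P \<and> (\<exists>u\<in>R. pr n u \<in> P \<and> u \<in> I)))"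

lemma in_radical_Int:
  assumes I: "is_ideal I" and J: "is_ideal J"
  shows "in_radical (I \<inter> J) a \<longleftrightarrow> in_radical I a \<and> in_radical J a"
proof
  assume "in_radical I a \<and> in_radical J a"
  then obtain n P u m P' v where a: "a \<in> R"
    and n: "n \<in> Num" "n0 \<^bold>\<prec> n" "power_seq a P" "u \<in> R" "pr n u \<in> P" "u \<in> I"
    and m: "m \<in> Num" "power_seq a P'" "v \<in> R" "pr m v \<in> P'" "v \<in> J"
    unfolding in_radical_def by blast
  \<comment> \<open>From here on both memberships are read off the single sequence P.\<close>
  have "pr m v \<in> P" using power_seq_subset[OF m(2) n(3) a m(1,3,4)] .
  then obtain y where y: "y \<in> R" "pr (m \<^bold>\<oplus> n) y \<in> P" "y \<in> J"
    using ideal_power_add[OF n(3) J a m(1,3) _ m(5) n(1)] by blast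
  obtain x where x: "x \<in> R" "pr (n \<^bold>\<oplus> m) x \<in> P" "x \<in> I"
    using ideal_power_add[OF n(3) I a n(1,4,5,6) m(1)] by blast
  \<comment> \<open>The exponents n + m and m + n agree by commutativity in the model, so both
    elements are the value of P at the same place.\<close>
  have "x = y"
    using power_seq_unique[OF n(3), of "n \<^bold>\<oplus> m" x y] x y n(1) m(1) add_commute by simp
  moreover have "n0 \<^bold>\<prec> n \<^bold>\<oplus> m" using n(1,2) m(1) by (intro less_add) simp_all
  ultimately show "in_radical (I \<inter> J) a"
    unfolding in_radical_def using a x y n(1) m(1) n(3) power_seq_Sub[OF n(3)]
    by (intro conjI bexI[of _ "n \<^bold>\<oplus> m"] bexI[of _ P] bexI[of _ x]) simp_all
qed (auto simp: in_radical_def)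

lemma comaximal_of_radicals:
  assumes I: "is_ideal I" and J: "is_ideal J"
    and i: "in_radical I i" and j: "in_radical J j" and sum: "op A i j rone" and r: "r \<in> R"
  shows "\<exists>x\<in>R. \<exists>y\<in>R. x \<in> I \<and> y \<in> J \<and> op A x y r"
proof -
  obtain n P u where n: "i \<in> R" "n \<in> Num" "power_seq i P" "u \<in> R" "pr n u \<in> P" "u \<in> I"
    using i unfolding in_radical_def by blast
  obtain m P' v where m: "j \<in> R" "m \<in> Num" "power_seq j P'" "v \<in> R" "pr m v \<in> P'" "v \<in> J"
    using j unfolding in_radical_def by blast
  \<comment> \<open>In the first use of \<open>comaximal_power\<close> the base is i, the fixed
    summand is j and the cofactor of the base is 1.\<close>
  have "rone = j \<oplus>\<^bsub>\<R>\<^esub> i \<otimes>\<^bsub>\<R>\<^esub> rone"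
    using sum n(1) m(1) r_one[of i] A_comm_fun[of i j] by (simp add: op_A_iff)
  from comaximal_power[OF n(3) m(1) n(1) const(2) this n(2)]
  obtain p d e where p: "p \<in> R" "d \<in> R" "e \<in> R" "pr n p \<in> P" "rone = p \<otimes>\<^bsub>\<R>\<^esub> d \<oplus>\<^bsub>\<R>\<^esub> j \<otimes>\<^bsub>\<R>\<^esub> e"
    by blast
  have "p = u" using power_seq_unique[OF n(3,2)] p n by blast
  have "p \<otimes>\<^bsub>\<R>\<^esub> d \<in> R" using p by simp
  \<comment> \<open>In the second use the base is j with cofactor e, and the fixed summand is p
    times d, which already contains the power of i.\<close>
  from comaximal_power[OF m(3) this m(1) p(3,5) m(2)]
  obtain q f g where q: "q \<in> R" "f \<in> R" "g \<in> R" "pr m q \<in> P'"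
    "rone = q \<otimes>\<^bsub>\<R>\<^esub> f \<oplus>\<^bsub>\<R>\<^esub> p \<otimes>\<^bsub>\<R>\<^esub> d \<otimes>\<^bsub>\<R>\<^esub> g" by blast
  have "q = v" using power_seq_unique[OF m(3,2)] q m by blast
  \<comment> \<open>These are the two summands of r times 1 = v f + u d g. The ideal element is
    moved to the right end, where \<open>ideal_mult\<close> expects it.\<close>
  define x y where xy: "x = r \<otimes>\<^bsub>\<R>\<^esub> d \<otimes>\<^bsub>\<R>\<^esub> g \<otimes>\<^bsub>\<R>\<^esub> u" "y = r \<otimes>\<^bsub>\<R>\<^esub> f \<otimes>\<^bsub>\<R>\<^esub> v"
  have carr: "r \<in> carrier \<R>" "d \<in> carrier \<R>" "g \<in> carrier \<R>" "u \<in> carrier \<R>" "f \<in> carrier \<R>" "v \<in> carrier \<R>"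
    using r p q n m by simp_all
  have "r = r \<otimes>\<^bsub>\<R>\<^esub> rone" using r r_one[of r] by simp
  also have "\<dots> = r \<otimes>\<^bsub>\<R>\<^esub> (v \<otimes>\<^bsub>\<R>\<^esub> f \<oplus>\<^bsub>\<R>\<^esub> u \<otimes>\<^bsub>\<R>\<^esub> d \<otimes>\<^bsub>\<R>\<^esub> g)"
    using q(5) \<open>p = u\<close> \<open>q = v\<close> by simp
  also have "\<dots> = x \<oplus>\<^bsub>\<R>\<^esub> y" unfolding xy using carr by algebra
  finally have "r = x \<oplus>\<^bsub>\<R>\<^esub> y" .
  moreover have "x \<in> R" "y \<in> R" "x \<in> I" "y \<in> J"
    using carr n m by (auto simp: xy intro!: ideal_mult[OF I] ideal_mult[OF J])
  ultimately show ?thesis using op_simps(1) by blast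
qed

section \<open>Meaning of the defining formulas in the model\<close>

lemma sat_powers:
  assumes "E ''R'' = R" "E ''M'' = M" "e ''one'' = rone" "E P \<in> Sub" "x \<notin> {''k'', ''u'', ''v'', ''w''}"
  shows "sat \<M> e E (powers (V x) P) \<longleftrightarrow> power_seq (e x) (E P)"
  using assms by (simp add: powers_def Let_def power_seq_def)

text \<open>The last premise says that C denotes I at the place inside \<open>radical\<close> where
  C is evaluated, after \<open>n\<close>, \<open>P\<close> and \<open>u\<close> have been bound.
  This covers a set and an intersection of sets alike. The excluded names are the number variables
  bound there.\<close>

lemma sat_radical:
  assumes "E ''R'' = R" "E ''M'' = M" "e ''one'' = rone" "x \<notin> {''k'', ''n'', ''u'', ''v'', ''w''}"
    and "\<And>n P u. u \<in> R \<Longrightarrow> sat \<M> (e(''n'' := n, ''u'' := u)) (E(''P'' := P)) (C (V ''u'')) \<longleftrightarrow> u \<in> I"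
  shows "sat \<M> e E (radical C (V x)) \<longleftrightarrow> in_radical I (e x)"
  using assms by (simp add: radical_def in_radical_def sat_powers)

lemma sat_ideal:
  assumes "E ''R'' = R" "E ''A'' = A" "E ''M'' = M" "e ''zero'' = rzero" "E X \<in> Sub"
  shows "sat \<M> e E (ideal X) \<longleftrightarrow> is_ideal (E X)"
  using assms unfolding is_ideal_def ideal_def Let_def by simp

end

section \<open>Validity of the two sentences\<close>

context rca0_model
begin

lemma valid_comaximal:
  "valid \<M> (for_all_rings (for_all_ideals ''I'' ''J''
      (comaximal (radical (set_class ''I'')) (radical (set_class ''J'')) \<^bold>\<longrightarrow>
       comaximal (set_class ''I'') (set_class ''J''))))"
  unfolding valid_def for_all_rings_def for_all_ideals_def sat.simps sat_And
proof (intro allI impI ballI, elim conjE)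
  fix e :: "var \<Rightarrow> 'a" and E :: "var \<Rightarrow> 'a set" and R A M rzero rone I J
  assume e: "\<forall>x. e x \<in> Num" and E: "\<forall>X. E X \<in> Sub"
    and S: "R \<in> Sub" "A \<in> Sub" "M \<in> Sub" "rzero \<in> Num" "rone \<in> Num" "I \<in> Sub" "J \<in> Sub"
  let ?e = "e(''zero'' := rzero, ''one'' := rone)" and ?E = "E(''R'' := R, ''A'' := A, ''M'' := M)"
  let ?F = "?E(''I'' := I, ''J'' := J)"
  assume ring: "sat \<M> ?e ?E comm_ring"
    and ideals: "sat \<M> ?e ?F (ideal ''I'')" "sat \<M> ?e ?F (ideal ''J'')"
    and rad: "sat \<M> ?e ?F (comaximal (radical (set_class ''I'')) (radical (set_class ''J'')))"
  interpret rca0_ring \<M> R A M rzero rone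
    using rca0_ringI[OF ring] E S by simp
  have I: "is_ideal I" "is_ideal J" using ideals S by (simp_all add: sat_ideal)
  have "\<forall>r\<in>R. \<exists>i\<in>R. \<exists>j\<in>R. in_radical I i \<and> in_radical J j \<and> op A i j r"
    using rad S by (simp add: comaximal_def sat_radical[where I = I] sat_radical[where I = J] set_class_def)
  \<comment> \<open>Instance r = 1; an arbitrary r is reached by multiplication inside
    \<open>comaximal_of_radicals\<close>.\<close>
  then obtain i j where "in_radical I i" "in_radical J j" "op A i j rone"
    using const(2) by blast
  then show "sat \<M> ?e ?F (comaximal (set_class ''I'') (set_class ''J''))"
    using comaximal_of_radicals[OF I] S by (simp add: comaximal_def set_class_def)
qed

lemma valid_radical_Int:
  "valid \<M> (for_all_rings (for_all_ideals ''I'' ''J''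
      (class_eq (radical (inter_class (set_class ''I'') (set_class ''J'')))
                (inter_class (radical (set_class ''I'')) (radical (set_class ''J''))))))"
  unfolding valid_def for_all_rings_def for_all_ideals_def sat.simps sat_And
proof (intro allI impI ballI, elim conjE)
  fix e :: "var \<Rightarrow> 'a" and E :: "var \<Rightarrow> 'a set" and R A M rzero rone I J
  assume e: "\<forall>x. e x \<in> Num" and E: "\<forall>X. E X \<in> Sub"
    and S: "R \<in> Sub" "A \<in> Sub" "M \<in> Sub" "rzero \<in> Num" "rone \<in> Num" "I \<in> Sub" "J \<in> Sub"
  let ?e = "e(''zero'' := rzero, ''one'' := rone)" and ?E = "E(''R'' := R, ''A'' := A, ''M'' := M)"
  let ?F = "?E(''I'' := I, ''J'' := J)"
  assume ring: "sat \<M> ?e ?E comm_ring"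
    and ideals: "sat \<M> ?e ?F (ideal ''I'')" "sat \<M> ?e ?F (ideal ''J'')"
  interpret rca0_ring \<M> R A M rzero rone
    using rca0_ringI[OF ring] E S by simp
  have I: "is_ideal I" "is_ideal J" using ideals S by (simp_all add: sat_ideal)
  have "sat \<M> (?e(''a'' := a)) ?F (radical (inter_class (set_class ''I'') (set_class ''J'')) (V ''a''))
    \<longleftrightarrow> in_radical (I \<inter> J) a"
    "sat \<M> (?e(''a'' := a)) ?F (radical (set_class ''I'') (V ''a'')) \<longleftrightarrow> in_radical I a"
    "sat \<M> (?e(''a'' := a)) ?F (radical (set_class ''J'') (V ''a'')) \<longleftrightarrow> in_radical J a" for a
    by (subst sat_radical; simp add: set_class_def inter_class_def)+
  then show "sat \<M> ?e ?F (class_eq (radical (inter_class (set_class ''I'') (set_class ''J'')))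
                (inter_class (radical (set_class ''I'')) (radical (set_class ''J''))))"
    \<comment> \<open>Only the intersection of the two radicals is unfolded. The one under
      \<open>radical\<close> stays folded, and the assignments stay unsimplified, so that the three
      equivalences match.\<close>
    by (simp add: class_eq_def in_radical_Int[OF I] inter_class_def[of "radical _"] del: fun_upd_apply)
qed

end

theorem theorem4p9:
  "RCA0 \<turnstile> for_all_rings (for_all_ideals ''I'' ''J''
      (comaximal (radical (set_class ''I'')) (radical (set_class ''J'')) \<^bold>\<longrightarrow>
       comaximal (set_class ''I'') (set_class ''J''))) \<and>
   RCA0 \<turnstile> for_all_rings (for_all_ideals ''I'' ''J''
      (class_eq (radical (inter_class (set_class ''I'') (set_class ''J'')))
                (inter_class (radical (set_class ''I'')) (radical (set_class ''J'')))))"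
  by (intro conjI completeness rca0_model.valid_comaximal rca0_model.valid_radical_Int
      rca0_model.intro)

end
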